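(* Let $R$ be a complete discrete valuation ring and let $\pi\in R$ be a generator of its maximal ideal. Let $f(X)\in R[X]$ be a monic polynomial with discriminant $\Delta(f)\neq 0$. Let $n\ge 1$ and let $g_{(1)}(X),\dots,g_{(n)}(X)\in R[X]$ be monic polynomials of degree $\ge 1$. Write $t:=\mathrm{v}_\pi(\mathrm{Res}(g_{(1)},\dots,g_{(n)}))$. Let $s$ be an integer with $s\ge \mathrm{v}_\pi(\Delta(f))+1$ and suppose that $$f(X)\equiv_{\pi^s}\prod_{k\in[1,n]} g_{(k)}(X).$$ Then there exist unique monic polynomials $\check g_{(1)}(X),\dots,\check g_{(n)}(X)\in R[X]$ such that $$\check g_{(k)}(X)\equiv_{\pi^{s-t}} g_{(k)}(X)\ \text{ for } k\in[1,n]\qquad\text{and}\qquad f(X)=\prod_{k\in[1,n]}\check g_{(k)}(X).$$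
   Context: Notation: $[a,b]=\{z\in\mathbb{Z}: a\le z\le b\}$. For $u\in R$ and $x,y$ in $R$ (resp. $R[X]$), $x\equiv_u y$ means $x-y\in uR$ (resp. $x-y\in uR[X]$). For $x\in R\setminus\{0\}$, $\mathrm{v}_\pi(x)=\max\{i\in\mathbb{Z}_{\ge0}:\pi^i\text{ divides }x\}$, and $\mathrm{v}_\pi(0)=+\infty$. The discriminant of a monic polynomial with roots $\alpha_1,\dots,\alpha_m$ (with multiplicity) in a splitting field over the fraction field is $\prod_{1\le i<j\le m}(\alpha_i-\alpha_j)^2$. Generalised Sylvester matrix and resultant: let $g_{(1)},\dots,g_{(n)}\in R[X]$ be monic of degrees $m_{(k)}:=\deg g_{(k)}\ge1$. Put $N:=\sum_{j\in[1,n]}m_{(j)}$, $N_{(k)}:=N-m_{(k)}$ and write $\prod_{j\in[1,n]\setminus\{k\}}g_{(j)}(X)=\sum_{i\in[0,N_{(k)}]}a_{(k)i}X^i$. Then $\mathrm{Sylv}(g_{(1)},\dots,g_{(n)})\in R^{N\times N}$ is the matrix consisting of $n$ consecutive blocks of rows, the $k$-th block having $m_{(k)}$ rows; for $p\in[1,m_{(k)}]$, the $p$-th row of the $k$-th block has entry $a_{(k)\,q-p}$ in column $q$ if $p\le q\le p+N_{(k)}$ and entry $0$ in all other columns $q\in[1,N]$. The resultant is $\mathrm{Res}(g_{(1)},\dots,g_{(n)}):=\det\mathrm{Sylv}(g_{(1)},\dots,g_{(n)})\in R$. In this setting $t$ is finite and $s\ge 2t+1$. *)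

theory Defs
  imports
    "HOL-Library.Extended_Nat"
    "HOL-Computational_Algebra.Computational_Algebra"
    "HOL-Algebra.Algebraic_Closure_Type"
    "Jordan_Normal_Form.Determinant"
begin

definition discrete_valuation_ring :: "('a, 'b) ring_scheme \<Rightarrow> bool" where
  "discrete_valuation_ring R \<longleftrightarrow>
     principal_domain R \<and> \<not> Ring.field R \<and> (\<exists>!M. maximalideal M R)"

text \<open>
  Convergence of Cauchy sequences in the \<open>\<pi>\<close>-adic topology. Uniqueness of limits is not part of the
  definition, as it is automatic in a discrete valuation ring with uniformizer \<open>\<pi>\<close>.
\<close>

definition adically_complete :: "'a::comm_ring_1 \<Rightarrow> bool" where
  "adically_complete \<pi> \<longleftrightarrow>
     (\<forall>x :: nat \<Rightarrow> 'a.
        (\<forall>i. \<exists>N. \<forall>m\<ge>N. \<forall>n\<ge>N. \<pi> ^ i dvd x m - x n) \<longrightarrow>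
        (\<exists>l. \<forall>i. \<exists>N. \<forall>n\<ge>N. \<pi> ^ i dvd x n - l))"

text \<open>The set under \<^const>\<open>Max\<close> is finite if \<open>\<pi>\<close> is a uniformizer and \<open>x \<noteq> 0\<close>.\<close>

definition valuation :: "'a::comm_semiring_1 \<Rightarrow> 'a \<Rightarrow> enat" where
  "valuation \<pi> x = (if x = 0 then \<infinity> else enat (Max {i. \<pi> ^ i dvd x}))"

definition poly_cong :: "'a::comm_ring_1 \<Rightarrow> 'a poly \<Rightarrow> 'a poly \<Rightarrow> bool" where
  "poly_cong u x y \<longleftrightarrow> x - y \<in> range (Polynomial.smult u)"

text \<open>The canonical map from a domain into an algebraic closure of its field of fractions.\<close>

definition embed_ac :: "'a::idom \<Rightarrow> 'a fract alg_closure" where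
  "embed_ac x = to_ac (to_fract x)"

definition splitting_roots :: "'a::idom poly \<Rightarrow> 'a fract alg_closure list \<Rightarrow> bool" where
  "splitting_roots f \<alpha>s \<longleftrightarrow> map_poly embed_ac f = (\<Prod>\<alpha>\<leftarrow>\<alpha>s. [:-\<alpha>, 1:])"

definition root_discriminant :: "'a::comm_ring_1 list \<Rightarrow> 'a" where
  "root_discriminant \<alpha>s = (\<Prod>j<length \<alpha>s. \<Prod>i<j. (\<alpha>s ! i - \<alpha>s ! j)\<^sup>2)"

text \<open>
  The discriminant of a monic polynomial as an element of its coefficient domain; the lemma
  \<open>embed_discriminant\<close> below shows that the description is proper for every monic polynomial.
\<close>

definition discriminant :: "'a::idom poly \<Rightarrow> 'a" where
  "discriminant f = (THE d. \<exists>\<alpha>s. splitting_roots f \<alpha>s \<and> embed_ac d = root_discriminant \<alpha>s)"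

text \<open>Rows and columns are counted from 0 here, as usual for \<^typ>\<open>'a mat\<close>.\<close>

definition gen_sylvester_mat :: "'a::comm_ring_1 poly list \<Rightarrow> 'a mat" where
  "gen_sylvester_mat gs =
     (let n = length gs;
          m = (\<lambda>k. Polynomial.degree (gs ! k));
          N = (\<Sum>k<n. m k);
          a = (\<lambda>k. Polynomial.coeff (\<Prod>j\<in>{..<n} - {k}. gs ! j))
      in mat_of_rows N
           (concat (map (\<lambda>k.
              map (\<lambda>p. vec N (\<lambda>q. if p \<le> q \<and> q \<le> p + (N - m k) then a k (q - p) else 0))
                [0..<m k]) [0..<n])))"

definition gen_resultant :: "'a::comm_ring_1 poly list \<Rightarrow> 'a" where
  "gen_resultant gs = Determinant.det (gen_sylvester_mat gs)"

lemma embed_ac_hom: "inj_comm_ring_hom (embed_ac :: 'a::idom \<Rightarrow> _)"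
  by unfold_locales
    (auto simp: embed_ac_def to_fract_def One_fract_def Zero_fract_def eq_fract
          simp flip: to_ac_add to_ac_mult)

lemma embed_ac_0 [simp]: "embed_ac 0 = 0"
  and embed_ac_1 [simp]: "embed_ac 1 = 1"
  and embed_ac_eq_0_iff [simp]: "embed_ac x = 0 \<longleftrightarrow> x = 0"
  by (simp_all add: embed_ac_def to_fract_def eq_fract flip: One_fract_def Zero_fract_def)
    (simp add: Zero_fract_def eq_fract)

lemma degree_map_embed_ac [simp]: "Polynomial.degree (map_poly embed_ac f) = Polynomial.degree f"
  by (rule degree_map_poly) simp

lemma coeff_map_embed_ac [simp]:
  "Polynomial.coeff (map_poly embed_ac f) i = embed_ac (Polynomial.coeff f i)"
  by (simp add: coeff_map_poly)

lemma fps_power_sums: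
  fixes \<alpha>s :: "'a::field list"
  defines "F \<equiv> fps_of_poly (reflect_poly (\<Prod>\<alpha>\<leftarrow>\<alpha>s. [:-\<alpha>, 1:]))"
  shows "Abs_fps (\<lambda>k. \<Sum>\<alpha>\<leftarrow>\<alpha>s. \<alpha> ^ k) * F = of_nat (length \<alpha>s) * F - fps_X * fps_deriv F"
  unfolding F_def
proof (induction \<alpha>s)
  case Nil
  then show ?case by (simp add: fps_eq_iff)
next
  case (Cons a l)
  let ?F = "fps_of_poly (reflect_poly (\<Prod>\<alpha>\<leftarrow>l. [:-\<alpha>, 1:]))"
  let ?P = "Abs_fps (\<lambda>k. \<Sum>\<alpha>\<leftarrow>l. \<alpha> ^ k)"
  let ?L = "1 - fps_const a * fps_X :: 'a fps"
  have "reflect_poly [:-a, 1:] = [:1, -a:]"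
    by (simp add: reflect_poly_def)
  then have F: "fps_of_poly (reflect_poly (\<Prod>\<alpha>\<leftarrow>a # l. [:-\<alpha>, 1:])) = ?L * ?F"
    by (simp add: reflect_poly_mult fps_of_poly_mult fps_of_poly_pCons mult_ac del: mult_pCons_left)
  have geom: "Abs_fps (\<lambda>k. a ^ k) * ?L = 1"
  proof (rule fps_ext)
    fix k show "fps_nth (Abs_fps (\<lambda>k. a ^ k) * ?L) k = fps_nth 1 k"
      by (cases k) (simp_all add: algebra_simps)
  qed
  have P: "Abs_fps (\<lambda>k. \<Sum>\<alpha>\<leftarrow>a # l. \<alpha> ^ k) = Abs_fps (\<lambda>k. a ^ k) + ?P"
    by (simp add: fps_ext)
  have "(Abs_fps (\<lambda>k. a ^ k) + ?P) * (?L * ?F) = (Abs_fps (\<lambda>k. a ^ k) * ?L) * ?F + ?L * (?P * ?F)"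
    by (simp add: algebra_simps)
  also have "\<dots> = ?F + ?L * (of_nat (length l) * ?F - fps_X * fps_deriv ?F)"
    unfolding geom Cons.IH by simp
  also have "\<dots> = of_nat (length (a # l)) * (?L * ?F) - fps_X * fps_deriv (?L * ?F)"
    by (simp add: algebra_simps)
  finally show ?case unfolding F P .
qed

lemma lead_coeff_prod_linear: "lead_coeff (\<Prod>\<alpha>\<leftarrow>\<alpha>s. [:-\<alpha>, 1 :: 'a::idom:]) = 1"
  and degree_prod_linear: "Polynomial.degree (\<Prod>\<alpha>\<leftarrow>\<alpha>s. [:-\<alpha>, 1 :: 'a::idom:]) = length \<alpha>s"
proof -
  have "lead_coeff (\<Prod>\<alpha>\<leftarrow>\<alpha>s. [:-\<alpha>, 1 :: 'a:]) = 1 \<and>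
    Polynomial.degree (\<Prod>\<alpha>\<leftarrow>\<alpha>s. [:-\<alpha>, 1 :: 'a:]) = length \<alpha>s"
  proof (induction \<alpha>s)
    case (Cons a l)
    let ?p = "\<Prod>\<alpha>\<leftarrow>l. [:-\<alpha>, 1 :: 'a:]"
    have "?p \<noteq> 0" using Cons by force
    then have "Polynomial.degree ([:-a, 1:] * ?p) = Suc (length l)"
      using Cons by (subst degree_mult_eq) auto
    moreover have "lead_coeff ([:-a, 1:] * ?p) = 1"
      using Cons by (subst lead_coeff_mult) auto
    ultimately show ?case by simp
  qed auto
  then show "lead_coeff (\<Prod>\<alpha>\<leftarrow>\<alpha>s. [:-\<alpha>, 1 :: 'a:]) = 1"
    "Polynomial.degree (\<Prod>\<alpha>\<leftarrow>\<alpha>s. [:-\<alpha>, 1 :: 'a:]) = length \<alpha>s" by auto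
qed

lemma splitting_roots_exist:
  assumes "lead_coeff f = 1"
  shows "\<exists>\<alpha>s. splitting_roots f \<alpha>s"
proof -
  interpret inj_comm_ring_hom "embed_ac :: 'a \<Rightarrow> _" by (rule embed_ac_hom)
  let ?g = "map_poly embed_ac f"
  have "lead_coeff ?g = 1" using assms by simp
  then obtain A where "?g = (\<Prod>x\<in>#A. [:-x, 1:])"
    using alg_closed_imp_factorization[of ?g] by fastforce
  moreover obtain \<alpha>s where "A = mset \<alpha>s" by (metis ex_mset)
  ultimately show ?thesis
    unfolding splitting_roots_def by (metis mset_map prod_mset_prod_list)
qed

lemma splitting_roots_length:
  assumes "splitting_roots f \<alpha>s"
  shows "length \<alpha>s = Polynomial.degree f"
proof -
  interpret inj_comm_ring_hom "embed_ac :: 'a \<Rightarrow> _" by (rule embed_ac_hom)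
  show ?thesis using assms degree_prod_linear[of \<alpha>s] unfolding splitting_roots_def
    by (metis degree_map_embed_ac)
qed

lemma power_sums_in_domain:
  assumes "lead_coeff f = 1"
  shows "\<exists>x. \<forall>\<alpha>s. splitting_roots f \<alpha>s \<longrightarrow> embed_ac x = (\<Sum>\<alpha>\<leftarrow>\<alpha>s. \<alpha> ^ k)"
proof (induction k rule: less_induct)
  case (less k)
  interpret inj_comm_ring_hom "embed_ac :: 'a \<Rightarrow> _" by (rule embed_ac_hom)
  from less obtain q where q: "\<And>i \<alpha>s. i < k \<Longrightarrow> splitting_roots f \<alpha>s \<Longrightarrow>
      embed_ac (q i) = (\<Sum>\<alpha>\<leftarrow>\<alpha>s. \<alpha> ^ i)" by metis
  let ?c = "Polynomial.coeff (reflect_poly f)"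
  define x where "x = of_nat (Polynomial.degree f) * ?c k - of_nat k * ?c k - (\<Sum>i<k. q i * ?c (k - i))"
  have "embed_ac x = (\<Sum>\<alpha>\<leftarrow>\<alpha>s. \<alpha> ^ k)" if r: "splitting_roots f \<alpha>s" for \<alpha>s
  proof -
    define F where "F = fps_of_poly (reflect_poly (\<Prod>\<alpha>\<leftarrow>\<alpha>s. [:-\<alpha>, 1:]))"
    have c: "fps_nth F i = embed_ac (?c i)" for i
      by (simp add: F_def coeff_reflect_poly flip: r[unfolded splitting_roots_def])
    have "(\<Sum>i\<le>k. (\<Sum>\<alpha>\<leftarrow>\<alpha>s. \<alpha> ^ i) * fps_nth F (k - i)) = of_nat (length \<alpha>s) * fps_nth F k - of_nat k * fps_nth F k"
    proof -
      have "(\<Sum>i\<le>k. (\<Sum>\<alpha>\<leftarrow>\<alpha>s. \<alpha> ^ i) * fps_nth F (k - i)) =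
          fps_nth (Abs_fps (\<lambda>k. \<Sum>\<alpha>\<leftarrow>\<alpha>s. \<alpha> ^ k) * F) k"
        by (simp add: fps_mult_nth atMost_atLeast0)
      also have "\<dots> = fps_nth (fps_const (of_nat (length \<alpha>s)) * F - fps_X * fps_deriv F) k"
        using fps_power_sums[of \<alpha>s, folded F_def] by (simp only: fps_of_nat)
      also have "\<dots> = of_nat (length \<alpha>s) * fps_nth F k - of_nat k * fps_nth F k"
        unfolding fps_sub_nth fps_mult_left_const_nth
        by (cases k) (simp_all add: fps_X_mult_nth)
      finally show ?thesis .
    qed
    moreover have "(\<Sum>i\<le>k. (\<Sum>\<alpha>\<leftarrow>\<alpha>s. \<alpha> ^ i) * fps_nth F (k - i)) =
        (\<Sum>i<k. embed_ac (q i) * embed_ac (?c (k - i))) + (\<Sum>\<alpha>\<leftarrow>\<alpha>s. \<alpha> ^ k) * fps_nth F 0"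
      using q r by (simp add: c flip: lessThan_Suc_atMost)
    moreover have "fps_nth F 0 = 1" using assms by (simp add: c)
    ultimately show ?thesis
      by (simp add: x_def c hom_distribs splitting_roots_length[OF r] algebra_simps)
  qed
  then show ?case by blast
qed

lemma det_vandermonde:
  fixes \<alpha>s :: "'a::idom list"
  shows "Determinant.det (mat (length \<alpha>s) (length \<alpha>s) (\<lambda>(i, k). \<alpha>s ! i ^ k)) =
    (\<Prod>j<length \<alpha>s. \<Prod>i<j. \<alpha>s ! j - \<alpha>s ! i)"
proof -
  define n where "n = length \<alpha>s"
  define p where "p = (\<lambda>j. \<Prod>\<alpha>\<leftarrow>take j \<alpha>s. [:-\<alpha>, 1:])"
  define V where "V = mat n n (\<lambda>(i, k). \<alpha>s ! i ^ k)"
  define C where "C = mat n n (\<lambda>(k, j). Polynomial.coeff (p j) k)"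
  define W where "W = mat n n (\<lambda>(i, j). poly (p j) (\<alpha>s ! i))"
  have deg: "Polynomial.degree (p j) = j" if "j < n" for j
    using that by (simp add: p_def degree_prod_linear n_def)
  have lc: "lead_coeff (p j) = 1" for j
    unfolding p_def by (rule lead_coeff_prod_linear)
  have pp: "poly (p j) x = (\<Prod>i<j. x - \<alpha>s ! i)" if "j \<le> n" for j x
    using that
  proof (induction j)
    case (Suc j)
    then show ?case by (simp add: p_def take_Suc_conv_app_nth n_def algebra_simps)
  qed (simp add: p_def)
  have VC: "V * C = W"
  proof (rule eq_matI)
    fix i j assume "i < dim_row W" "j < dim_col W"
    then have ij: "i < n" "j < n" by (auto simp: W_def)
    have "(V * C) $$ (i, j) = (\<Sum>k<n. \<alpha>s ! i ^ k * Polynomial.coeff (p j) k)"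
      using ij by (simp add: V_def C_def scalar_prod_def atLeast0LessThan)
    also have "\<dots> = (\<Sum>k\<le>j. \<alpha>s ! i ^ k * Polynomial.coeff (p j) k)"
      using ij deg[of j] by (intro sum.mono_neutral_right) (auto simp: coeff_eq_0)
    also have "\<dots> = poly (p j) (\<alpha>s ! i)"
      using ij by (simp add: poly_altdef deg mult.commute)
    finally show "(V * C) $$ (i, j) = W $$ (i, j)" using ij by (simp add: W_def)
  qed (auto simp: V_def C_def W_def)
  have "Determinant.det C = prod_list (diag_mat C)"
    by (rule det_upper_triangular[of _ n]) (auto simp: C_def upper_triangular_def deg coeff_eq_0)
  also have "\<dots> = (\<Prod>j<n. Polynomial.coeff (p j) j)"
    by (simp add: prod_list_diag_prod C_def atLeast0LessThan)
  also have "\<dots> = 1" using lc deg by (intro prod.neutral) (metis lessThan_iff)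
  finally have detC: "Determinant.det C = 1" .
  have "Determinant.det W = prod_list (diag_mat W)"
    by (rule det_lower_triangular[of n]) (auto simp: W_def pp intro!: prod_zero)
  also have "\<dots> = (\<Prod>j<n. \<Prod>i<j. \<alpha>s ! j - \<alpha>s ! i)"
    by (simp add: prod_list_diag_prod W_def atLeast0LessThan pp)
  finally show ?thesis
    using det_mult[of V n C] VC detC by (simp add: V_def C_def n_def)
qed

lemma det_power_sums:
  fixes \<alpha>s :: "'a::idom list"
  shows "Determinant.det (mat (length \<alpha>s) (length \<alpha>s) (\<lambda>(i, j). \<Sum>\<alpha>\<leftarrow>\<alpha>s. \<alpha> ^ (i + j))) =
    root_discriminant \<alpha>s"
proof -
  define n where "n = length \<alpha>s"
  define V where "V = mat n n (\<lambda>(i, k). \<alpha>s ! i ^ k)"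
  have "mat n n (\<lambda>(i, j). \<Sum>\<alpha>\<leftarrow>\<alpha>s. \<alpha> ^ (i + j)) = transpose_mat V * V"
    by (rule eq_matI) (auto simp: V_def scalar_prod_def power_add sum_list_sum_nth n_def)
  moreover have "V \<in> carrier_mat n n" by (simp add: V_def)
  ultimately have "Determinant.det (mat n n (\<lambda>(i, j). \<Sum>\<alpha>\<leftarrow>\<alpha>s. \<alpha> ^ (i + j))) = (Determinant.det V)\<^sup>2"
    by (simp add: det_mult det_transpose power2_eq_square)
  also have "\<dots> = root_discriminant \<alpha>s"
    unfolding V_def n_def det_vandermonde root_discriminant_def
    by (simp add: prod_power_distrib power2_commute)
  finally show ?thesis by (simp add: n_def)
qed

lemma root_discriminant_in_domain:
  assumes "lead_coeff f = 1"
  shows "\<exists>d. \<forall>\<alpha>s. splitting_roots f \<alpha>s \<longrightarrow> embed_ac d = root_discriminant \<alpha>s"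
proof -
  interpret inj_comm_ring_hom "embed_ac :: 'a \<Rightarrow> _" by (rule embed_ac_hom)
  obtain q where q: "\<And>k \<alpha>s. splitting_roots f \<alpha>s \<Longrightarrow> embed_ac (q k) = (\<Sum>\<alpha>\<leftarrow>\<alpha>s. \<alpha> ^ k)"
    using power_sums_in_domain[OF assms] by metis
  define M where "M = mat (Polynomial.degree f) (Polynomial.degree f) (\<lambda>(i, j). q (i + j))"
  have "embed_ac (Determinant.det M) = root_discriminant \<alpha>s" if r: "splitting_roots f \<alpha>s" for \<alpha>s
  proof -
    have "map_mat embed_ac M = mat (length \<alpha>s) (length \<alpha>s) (\<lambda>(i, j). \<Sum>\<alpha>\<leftarrow>\<alpha>s. \<alpha> ^ (i + j))"
      by (rule eq_matI) (auto simp: M_def splitting_roots_length[OF r] q[OF r])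
    then show ?thesis using hom_det[of M] by (simp add: det_power_sums)
  qed
  then show ?thesis by blast
qed

lemma embed_discriminant:
  assumes "lead_coeff f = 1" and "splitting_roots f \<alpha>s"
  shows "embed_ac (discriminant f) = root_discriminant \<alpha>s"
proof -
  interpret inj_comm_ring_hom "embed_ac :: 'a \<Rightarrow> _" by (rule embed_ac_hom)
  obtain d where d: "\<And>\<alpha>s. splitting_roots f \<alpha>s \<Longrightarrow> embed_ac d = root_discriminant \<alpha>s"
    using root_discriminant_in_domain[OF assms(1)] by blast
  have "discriminant f = d"
    unfolding discriminant_def
  proof (rule the_equality)
    show "\<exists>\<alpha>s. splitting_roots f \<alpha>s \<and> embed_ac d = root_discriminant \<alpha>s"
      using assms(2) d by blast
  next
    fix e assume "\<exists>\<alpha>s. splitting_roots f \<alpha>s \<and> embed_ac e = root_discriminant \<alpha>s"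
    then have "embed_ac e = embed_ac d" using d by metis
    then show "e = d" by (rule injectivity)
  qed
  then show ?thesis using d assms(2) by simp
qed

end

theory Submission
  imports Defs
begin

text \<open>
  Evaluating the rows of the generalised Sylvester matrix at the roots of \<open>G = g\<^sub>1 \<cdots> g\<^sub>n\<close> multiplies
  it by a Vandermonde matrix. Replacing the powers \<open>X\<^sup>p\<close> within each block by the Newton basis of the
  roots of \<open>g\<^sub>k\<close> makes the product triangular, so that the resultant is the product of the differences
  of roots belonging to different factors, and hence \<open>\<Delta>(G) = Res\<^sup>2 \<Delta>(g\<^sub>1) \<cdots> \<Delta>(g\<^sub>n)\<close>. By Newton's
  identities the discriminant respects congruences, so \<open>v(\<Delta>(G)) = v(\<Delta>(f)) < s\<close> and therefore
  \<open>s \<ge> 2t + 1\<close>.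

  The Sylvester matrix describes the map \<open>(u\<^sub>k) \<mapsto> \<Sum>\<^sub>k u\<^sub>k \<Prod>\<^sub>j\<^sub>\<noteq>\<^sub>k g\<^sub>j\<close>, which is the differential of the
  product. Its adjugate solves \<open>\<pi>\<^sup>t b = \<Sum>\<^sub>k u\<^sub>k \<Prod>\<^sub>j\<^sub>\<noteq>\<^sub>k g\<^sub>j\<close>, which allows a Newton iteration gaining
  precision in each step because \<open>2(s - t) > s\<close>. The same linearisation shows that two solutions agree
  to ever higher powers of \<open>\<pi>\<close>.
\<close>

subsection \<open>Congruences\<close>

lemma dvd_diff_trans:
  fixes d :: "'a::comm_ring_1"
  assumes "d dvd a - b" "d dvd b - c"
  shows "d dvd a - c"
  using dvd_add[OF assms] by simp

lemma dvd_diff_sym: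
  fixes d :: "'a::comm_ring_1"
  assumes "d dvd a - b"
  shows "d dvd b - a"
  using assms by (metis dvd_minus_iff minus_diff_eq)

lemma dvd_diff_mult:
  fixes d :: "'a::comm_ring_1"
  assumes "d dvd a - b" "d dvd a' - b'"
  shows "d dvd a * a' - b * b'"
proof -
  have "a * a' - b * b' = (a - b) * a' + b * (a' - b')" by (simp add: algebra_simps)
  then show ?thesis using assms by simp
qed

lemma dvd_diff_sum:
  fixes d :: "'a::comm_ring_1"
  assumes "\<And>x. x \<in> S \<Longrightarrow> d dvd f x - g x"
  shows "d dvd sum f S - sum g S"
  using assms by (simp add: dvd_sum flip: sum_subtractf)

lemma dvd_diff_prod:
  fixes d :: "'a::comm_ring_1"
  assumes "\<And>x. x \<in> S \<Longrightarrow> d dvd f x - g x"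
  shows "d dvd prod f S - prod g S"
  using assms by (induction S rule: infinite_finite_induct) (auto intro: dvd_diff_mult)

text \<open>The Leibniz formula writes a determinant as a polynomial in the entries, and polynomial
  expressions respect congruences.\<close>

lemma dvd_diff_det:
  fixes d :: "'a::comm_ring_1"
  assumes "A \<in> carrier_mat n n" "B \<in> carrier_mat n n"
    and "\<And>i j. i < n \<Longrightarrow> j < n \<Longrightarrow> d dvd A $$ (i, j) - B $$ (i, j)"
  shows "d dvd Determinant.det A - Determinant.det B"
  unfolding det_def'[OF assms(1)] det_def'[OF assms(2)]
  by (intro dvd_diff_sum dvd_diff_mult dvd_diff_prod) (auto simp: assms(3))

lemma poly_cong_iff:
  fixes u :: "'a::comm_ring_1"
  shows "poly_cong u x y \<longleftrightarrow> [:u:] dvd x - y"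
  by (auto simp: poly_cong_def dvd_def)

lemma const_poly_dvd_diff_iff:
  fixes u :: "'a::idom"
  shows "[:u:] dvd x - y \<longleftrightarrow>
    (\<forall>i. u dvd Polynomial.coeff x i - Polynomial.coeff y i)"
  by (simp add: const_poly_dvd_iff)

lemma const_poly_power: "[:u:] ^ i = [:u ^ i:]" for u :: "'a::comm_semiring_1"
  by (induction i) (simp_all add: one_pCons mult.commute)

text \<open>If the degrees differed, the leading coefficient 1 of the longer polynomial would be
  congruent to 0 modulo the nonunit \<open>u\<close>.\<close>

lemma degree_eq_of_poly_cong:
  fixes u :: "'a::idom"
  assumes "[:u:] dvd x - y" "lead_coeff x = 1" "lead_coeff y = 1" "\<not> u dvd 1"
  shows "Polynomial.degree x = Polynomial.degree y"
proof -
  have le: "Polynomial.degree x \<le> Polynomial.degree y"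
    if "[:u:] dvd x - y" "lead_coeff x = 1" for x y
  proof (rule ccontr)
    assume "\<not> ?thesis"
    then have "Polynomial.coeff y (Polynomial.degree x) = 0" by (simp add: coeff_eq_0)
    then show False using that assms(4) unfolding const_poly_dvd_diff_iff
      by (metis diff_zero)
  qed
  show ?thesis using le[of x y] le[of y x] assms dvd_diff_sym[OF assms(1)] by simp
qed

subsection \<open>Complete discrete valuation rings\<close>

text \<open>Replaces ideals by divisibility of elements. The third claim rests on the uniqueness of
  the maximal ideal, the fourth on the ascending chain condition in a principal domain.\<close>

lemma dvr_uniformizer:
  fixes \<pi> :: "'a::idom"
  assumes dvr: "discrete_valuation_ring (ring_of_type_algebra :: 'a ring)"
    and max: "maximalideal (PIdl\<^bsub>ring_of_type_algebra\<^esub> \<pi>) ring_of_type_algebra"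
  shows "\<pi> \<noteq> 0" and "\<not> \<pi> dvd 1" and "\<And>w. \<not> \<pi> dvd w \<Longrightarrow> w dvd 1"
    and "\<And>x. (\<And>i. \<pi> ^ i dvd x) \<Longrightarrow> x = 0"
proof -
  define R where "R = (ring_of_type_algebra :: 'a ring)"
  have R: "carrier R = UNIV" "\<And>x y. x \<otimes>\<^bsub>R\<^esub> y = x * y" "\<one>\<^bsub>R\<^esub> = 1" "\<zero>\<^bsub>R\<^esub> = 0"
    by (simp_all add: R_def ring_of_type_algebra_def)
  interpret principal_domain R using dvr by (simp add: R_def discrete_valuation_ring_def)
  have PIdl: "PIdl\<^bsub>R\<^esub> a = {x. a dvd x}" for a
    by (auto simp: cgenideal_def R dvd_def mult.commute)
  have unique: "M = {x. \<pi> dvd x}" if "maximalideal M R" for M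
    using dvr that max unfolding discrete_valuation_ring_def R_def[symmetric] PIdl by blast
  show "\<pi> \<noteq> 0"
  proof
    assume "\<pi> = 0"
    then have "PIdl\<^bsub>R\<^esub> \<pi> = {\<zero>\<^bsub>R\<^esub>}" unfolding PIdl by (auto simp: R)
    then have "Ring.field R" using max zeromaximalideal_fieldI by (simp add: R_def)
    then show False using dvr by (simp add: discrete_valuation_ring_def R_def)
  qed
  show "\<not> \<pi> dvd 1"
  proof
    assume "\<pi> dvd 1"
    then have "{x. \<pi> dvd x} = UNIV" using dvd_trans[of \<pi> 1] by auto
    then show False
      using maximalideal.I_notcarr[OF max] unfolding R_def[symmetric] PIdl R by simp
  qed
  show "w dvd 1" if "\<not> \<pi> dvd w" for w
  proof (rule ccontr)
    assume "\<not> w dvd 1"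
    \<comment> \<open>An irreducible divisor of a nonunit generates a maximal ideal in a principal
      domain; uniqueness makes it the ideal of \<pi>, so \<pi> would divide
      \<open>w\<close>.\<close>
    then have "w \<notin> Units R" by (auto simp: Units_def R dvd_def mult.commute)
    moreover have "w \<noteq> 0" using that by auto
    ultimately obtain p where p: "ring_irreducible\<^bsub>R\<^esub> p" "p divides\<^bsub>R\<^esub> w"
      using exists_irreducible_divisor[of w] unfolding R by blast
    then have "maximalideal {x. p dvd x} R"
      using irreducible_imp_maximalideal[OF _ p(1)] unfolding PIdl R by blast
    then have "{x. p dvd x} = {x. \<pi> dvd x}" by (rule unique)
    moreover have "p dvd w" using p(2) by (auto simp: factor_def R)
    ultimately show False using that by auto
  qed
  show "x = 0" if div: "\<And>i. \<pi> ^ i dvd x" for x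
  proof (rule ccontr)
    assume "x \<noteq> 0"
    \<comment> \<open>Dividing out all powers gives \<open>y i = \<pi> * y (Suc i)\<close>, so the
      ideals of the \<open>y i\<close> ascend. Once the chain stops, \<open>y (Suc j)\<close> is a
      multiple of \<open>y j\<close> and \<pi> becomes a unit.\<close>
    obtain y where y: "\<And>i. x = \<pi> ^ i * y i" using div unfolding dvd_def by metis
    have "\<pi> \<noteq> 0" using div[of 1] \<open>x \<noteq> 0\<close> by auto
    have ySuc: "y i = \<pi> * y (Suc i)" for i
    proof -
      have "\<pi> ^ i * y i = \<pi> ^ i * (\<pi> * y (Suc i))"
        using y[of i] y[of "Suc i"] by (simp only: power_Suc ac_simps)
      then show ?thesis using \<open>\<pi> \<noteq> 0\<close> by simp
    qed
    have step: "y (Suc i) dvd y i" for i using ySuc by (metis dvd_triv_right)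
    have dvd: "y j dvd y i" if "i \<le> j" for i j
      using that by (induction j rule: dec_induct) (auto intro: dvd_trans step)
    define J where "J i = PIdl\<^bsub>R\<^esub> (y i)" for i
    have J: "J i = {x. y i dvd x}" for i by (simp add: J_def PIdl)
    have mono: "J i \<subseteq> J j" if "i \<le> j" for i j
      using dvd[OF that] by (auto simp: J intro: dvd_trans)
    have "subset.chain {I. ideal I R} (range J)"
      unfolding subset_chain_def
    proof (intro conjI ballI)
      show "range J \<subseteq> {I. ideal I R}"
        using cgenideal_ideal by (auto simp: J_def R)
    next
      fix A B assume "A \<in> range J" "B \<in> range J"
      then obtain i j where "A = J i" "B = J j" by blast
      then show "A \<subseteq> B \<or> B \<subseteq> A" using mono nat_le_linear[of i j] by blast
    qed
    then have "\<Union> (range J) \<in> range J"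
      by (intro ideal_chain_is_trivial) auto
    then obtain j where "\<Union> (range J) = J j" by blast
    moreover have "y (Suc j) \<in> J (Suc j)" by (simp add: J)
    ultimately have "y (Suc j) \<in> J j" by blast
    then obtain c where "y (Suc j) = y j * c" by (auto simp: J)
    then have "y (Suc j) * (\<pi> * c) = y (Suc j) * 1" using ySuc[of j] by (simp add: ac_simps)
    moreover have "y (Suc j) \<noteq> 0" using y[of "Suc j"] \<open>x \<noteq> 0\<close> by auto
    ultimately have "\<pi> * c = 1" using mult_left_cancel by blast
    then show False using \<open>\<not> \<pi> dvd 1\<close> by (metis dvd_triv_left)
  qed
qed

text \<open>The ring hypotheses of the lifting argument, phrased through elements alone so that no
  carrier or ideal occurs in it.\<close>

locale complete_dvr =
  fixes \<pi> :: "'a::idom"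
  assumes nonzero: "\<pi> \<noteq> 0"
    and not_unit: "\<not> \<pi> dvd 1"
    and unit: "\<not> \<pi> dvd w \<Longrightarrow> w dvd 1"
    and separated: "(\<And>i. \<pi> ^ i dvd x) \<Longrightarrow> x = 0"
    and complete: "adically_complete \<pi>"
begin

lemma finite_powers_dvd:
  assumes "x \<noteq> 0"
  shows "finite {i. \<pi> ^ i dvd x}"
proof -
  obtain j where "\<not> \<pi> ^ j dvd x" using separated assms by blast
  then have "{i. \<pi> ^ i dvd x} \<subseteq> {..<j}"
    by (auto simp flip: not_le intro: dvd_trans[OF le_imp_power_dvd])
  then show ?thesis by (rule finite_subset) simp
qed

text \<open>By separatedness only finitely many powers of \<pi> divide a nonzero element, so the
  \<open>Max\<close> in \<open>valuation\<close> is a genuine maximum.\<close>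

lemma valuation_eq_enat:
  assumes "x \<noteq> 0"
  obtains i where "valuation \<pi> x = enat i" "\<pi> ^ i dvd x" "\<not> \<pi> ^ Suc i dvd x"
proof -
  let ?S = "{i. \<pi> ^ i dvd x}"
  have fin: "finite ?S" "?S \<noteq> {}"
    using finite_powers_dvd[OF assms] by (auto intro: exI[of _ 0])
  from Max_in[OF fin] have "\<pi> ^ Max ?S dvd x" by simp
  moreover have "\<not> \<pi> ^ Suc (Max ?S) dvd x"
    using Max_ge[OF fin(1), of "Suc (Max ?S)"] by auto
  ultimately show ?thesis using that assms by (simp add: valuation_def)
qed

text \<open>A nonzero element is a power of \<pi> times a unit. A valuation bound \<open>t\<close>
  is expressed by non-divisibility by \<open>\<pi> ^ Suc t\<close>; this turns it into a quotient by
  which equations can be rescaled.\<close>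

lemma dvd_power_of_not_power_dvd:
  assumes "\<not> \<pi> ^ Suc t dvd x"
  shows "x dvd \<pi> ^ t"
proof -
  have "x \<noteq> 0" using assms by auto
  then obtain i where i: "\<pi> ^ i dvd x" "\<not> \<pi> ^ Suc i dvd x" by (rule valuation_eq_enat)
  have "i \<le> t"
  proof (rule ccontr)
    assume "\<not> i \<le> t"
    then have "\<pi> ^ Suc t dvd \<pi> ^ i" by (intro le_imp_power_dvd) simp
    then show False using i(1) assms dvd_trans by blast
  qed
  obtain w where w: "x = \<pi> ^ i * w" using i(1) by auto
  then have "\<not> \<pi> dvd w" using i(2) by (auto simp: mult_dvd_mono power_Suc2 simp del: power_Suc)
  then have "w dvd 1" by (rule unit)
  then have "x dvd \<pi> ^ i" using mult_dvd_mono[of "\<pi> ^ i" "\<pi> ^ i" w 1] by (simp add: w)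
  then show ?thesis using le_imp_power_dvd[OF \<open>i \<le> t\<close>] dvd_trans by blast
qed

lemma not_power_dvd_1: "r > 0 \<Longrightarrow> \<not> \<pi> ^ r dvd 1"
  using not_unit by (metis dvd_power dvd_trans)

text \<open>Telescoping makes the sequence Cauchy. The explicit precision of each term is what lets
  congruences pass to the limit.\<close>

lemma adic_limit:
  assumes "\<And>i. \<pi> ^ (r + i) dvd x (Suc i) - x i"
  obtains l where "\<And>i. \<pi> ^ (r + i) dvd x i - l"
proof -
  have step: "\<pi> ^ (r + i) dvd x j - x i" if "i \<le> j" for i j
    using that
  proof (induction j rule: dec_induct)
    case (step j)
    have "\<pi> ^ (r + i) dvd x (Suc j) - x j"
      using assms[of j] step by (meson add_left_mono dvd_trans le_imp_power_dvd)
    then show ?case using step.IH dvd_diff_trans by blast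
  qed simp
  have "\<exists>N. \<forall>m\<ge>N. \<forall>n\<ge>N. \<pi> ^ i dvd x m - x n" for i
  proof (intro exI allI impI)
    fix m n assume "i \<le> m" "i \<le> n"
    then have "\<pi> ^ (r + i) dvd x m - x n"
      using step[of i m] dvd_diff_sym[OF step[of i n]] dvd_diff_trans by blast
    then show "\<pi> ^ i dvd x m - x n" by (meson dvd_trans le_add2 le_imp_power_dvd)
  qed
  then obtain l where l: "\<And>i. \<exists>N. \<forall>n\<ge>N. \<pi> ^ i dvd x n - l"
    using complete unfolding adically_complete_def by blast
  have "\<pi> ^ (r + i) dvd x i - l" for i
  proof -
    obtain N where "\<forall>n\<ge>N. \<pi> ^ (r + i) dvd x n - l" using l by blast
    \<comment> \<open>The threshold \<open>N\<close> may lie beyond \<open>i\<close>, so a later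
      term bridges the gap.\<close>
    then have "\<pi> ^ (r + i) dvd x (max N i) - l" by simp
    then show ?thesis using dvd_diff_sym[OF step[of i "max N i"]] dvd_diff_trans by auto
  qed
  then show ?thesis by (rule that)
qed

end

subsection \<open>The generalised Sylvester matrix\<close>

text \<open>Decodes row numbers of the Sylvester matrix: entry r is the pair of the block of row r
  and its position within that block, both counted from 0.\<close>

definition row_index :: "(nat \<Rightarrow> nat) \<Rightarrow> nat \<Rightarrow> (nat \<times> nat) list" where
  "row_index m n = concat (map (\<lambda>k. map (Pair k) [0..<m k]) [0..<n])"

definition block_less :: "nat \<times> nat \<Rightarrow> nat \<times> nat \<Rightarrow> bool" where
  "block_less x y \<longleftrightarrow> fst x < fst y \<or> fst x = fst y \<and> snd x < snd y"

lemma set_row_index: "set (row_index m n) = (SIGMA k:{..<n}. {..<m k})"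
  by (auto simp: row_index_def)

lemma sorted_row_index: "sorted_wrt block_less (row_index m n)"
  by (induction n) (auto simp: row_index_def sorted_wrt_append sorted_wrt_map block_less_def)

lemma length_row_index: "length (row_index m n) = (\<Sum>k<n. m k)"
  by (induction n) (simp_all add: row_index_def)

lemma row_index_less_iff:
  assumes "i < length (row_index m n)" "j < length (row_index m n)"
  shows "block_less (row_index m n ! i) (row_index m n ! j) \<longleftrightarrow> i < j"
proof -
  have less: "block_less (row_index m n ! i) (row_index m n ! j)"
    if "i < j" "j < length (row_index m n)" for i j
    using sorted_wrt_nth_less[OF sorted_row_index that] .
  show ?thesis
    using less[of i j] less[of j i] assms by (cases i j rule: linorder_cases) (auto simp: block_less_def)
qed

lemma distinct_row_index: "distinct (row_index m n)"
  unfolding distinct_conv_nth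
  by (metis block_less_def less_irrefl nat_neq_iff row_index_less_iff)

lemma bij_betw_row_index:
  "bij_betw ((!) (row_index m n)) {..<\<Sum>k<n. m k} (SIGMA k:{..<n}. {..<m k})"
  using bij_betw_nth[OF distinct_row_index] by (simp add: length_row_index set_row_index)

lemma sum_row_index:
  "(\<Sum>r<(\<Sum>k<n. m k). h (row_index m n ! r)) = sum h (SIGMA k:{..<n}. {..<m k})"
  by (rule sum.reindex_bij_betw[OF bij_betw_row_index])

lemma prod_row_index:
  "(\<Prod>r<(\<Sum>k<n. m k). h (row_index m n ! r)) = prod h (SIGMA k:{..<n}. {..<m k})"
  by (rule prod.reindex_bij_betw[OF bij_betw_row_index])

text \<open>Trades row numbers for an indicator over all positions, so that Vandermonde products can
  be regrouped by blocks.\<close>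

lemma prod_row_index_less:
  assumes "r < (\<Sum>k<n. m k)"
  shows "(\<Prod>i<r. h (row_index m n ! i)) =
    (\<Prod>x\<in>(SIGMA k:{..<n}. {..<m k}). if block_less x (row_index m n ! r) then h x else 1)"
proof -
  let ?L = "row_index m n"
  have "(\<Prod>x\<in>(SIGMA k:{..<n}. {..<m k}). if block_less x (?L ! r) then h x else 1) =
      (\<Prod>i<(\<Sum>k<n. m k). if block_less (?L ! i) (?L ! r) then h (?L ! i) else 1)"
    by (simp add: prod_row_index flip: prod_row_index[where h = "\<lambda>x. if block_less x (?L ! r) then h x else 1"])
  also have "\<dots> = (\<Prod>i<(\<Sum>k<n. m k). if i < r then h (?L ! i) else 1)"
    using assms by (intro prod.cong) (simp_all add: row_index_less_iff length_row_index)
  also have "\<dots> = (\<Prod>i<r. h (?L ! i))"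
    using assms by (intro prod.mono_neutral_cong_right) auto
  finally show ?thesis by simp
qed

section \<open>Rows of the matrix as coefficient vectors of polynomials\<close>

definition prod_except :: "'a::comm_semiring_1 poly list \<Rightarrow> nat \<Rightarrow> 'a poly" where
  "prod_except gs k = (\<Prod>j\<in>{..<length gs} - {k}. gs ! j)"

abbreviation total_degree :: "'a::zero poly list \<Rightarrow> nat" where
  "total_degree gs \<equiv> \<Sum>k<length gs. Polynomial.degree (gs ! k)"

abbreviation row_pos :: "'a::zero poly list \<Rightarrow> nat \<Rightarrow> nat \<times> nat" where
  "row_pos gs r \<equiv> row_index (\<lambda>k. Polynomial.degree (gs ! k)) (length gs) ! r"

abbreviation positions :: "'a::zero poly list \<Rightarrow> (nat \<times> nat) set" where
  "positions gs \<equiv> SIGMA k:{..<length gs}. {..<Polynomial.degree (gs ! k)}"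

lemma row_pos_in_positions: "r < total_degree gs \<Longrightarrow> row_pos gs r \<in> positions gs"
  using bij_betwE[OF bij_betw_row_index] by blast

lemma degree_prod_except_le:
  assumes "k < length gs"
  shows "Polynomial.degree (prod_except gs k) + Polynomial.degree (gs ! k) \<le> total_degree gs"
proof -
  have "Polynomial.degree (prod_except gs k) \<le> (\<Sum>j\<in>{..<length gs} - {k}. Polynomial.degree (gs ! j))"
    unfolding prod_except_def using degree_prod_sum_le[of _ "(!) gs"] by (simp add: o_def)
  then show ?thesis using assms
    by (subst sum.remove[of _ k]) auto
qed

text \<open>The product of the other factors has degree at most \<open>N - m k\<close>, so the upper
  cut-off in the definition of the matrix discards only zero coefficients.\<close>

lemma gen_sylvester_mat_eq:
  "gen_sylvester_mat gs = mat (total_degree gs) (total_degree gs)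
     (\<lambda>(r, q). Polynomial.coeff
        (Polynomial.monom 1 (snd (row_pos gs r)) * prod_except gs (fst (row_pos gs r))) q)"
proof -
  define N where "N = total_degree gs"
  define m where "m = (\<lambda>k. Polynomial.degree (gs ! k))"
  define L where "L = row_index m (length gs)"
  define row where "row = (\<lambda>(k, p). vec N (\<lambda>q. if p \<le> q \<and> q \<le> p + (N - m k)
    then Polynomial.coeff (prod_except gs k) (q - p) else 0))"
  have "gen_sylvester_mat gs = mat_of_rows N (map row L)"
    by (simp add: gen_sylvester_mat_def Let_def N_def m_def L_def row_index_def row_def
        prod_except_def map_concat o_def cong: if_cong)
  also have "\<dots> = mat N N (\<lambda>(r, q). Polynomial.coeff
      (Polynomial.monom 1 (snd (L ! r)) * prod_except gs (fst (L ! r))) q)"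
  proof (rule eq_matI)
    fix r q
    assume "r < dim_row (mat N N (\<lambda>(r, q). Polynomial.coeff
      (Polynomial.monom 1 (snd (L ! r)) * prod_except gs (fst (L ! r))) q))"
     and "q < dim_col (mat N N (\<lambda>(r, q). Polynomial.coeff
      (Polynomial.monom 1 (snd (L ! r)) * prod_except gs (fst (L ! r))) q))"
    then have rq: "r < N" "q < N" by simp_all
    have len: "length L = N" by (simp add: L_def N_def m_def length_row_index)
    obtain k p where kp: "L ! r = (k, p)" by force
    have "k < length gs" using rq len set_row_index kp unfolding L_def
      by (metis (no_types, lifting) SigmaE fst_conv lessThan_iff nth_mem prod.inject)
    then have "Polynomial.degree (prod_except gs k) \<le> N - m k"
      using degree_prod_except_le[of k gs] by (simp add: N_def m_def)
    then show "mat_of_rows N (map row L) $$ (r, q) = mat N N (\<lambda>(r, q). Polynomial.coeff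
      (Polynomial.monom 1 (snd (L ! r)) * prod_except gs (fst (L ! r))) q) $$ (r, q)"
      using rq len by (auto simp: mat_of_rows_index kp row_def coeff_monom_mult coeff_eq_0)
  qed (simp_all add: N_def m_def L_def length_row_index)
  finally show ?thesis by (simp add: N_def m_def L_def)
qed

lemma gen_sylvester_mat_carrier: "gen_sylvester_mat gs \<in> carrier_mat (total_degree gs) (total_degree gs)"
  by (simp add: gen_sylvester_mat_eq)

text \<open>Ensures that multiplying a row by the powers of x evaluates the whole row polynomial at
  x.\<close>

lemma degree_sylvester_row:
  assumes "(k, p) \<in> positions gs"
  shows "Polynomial.degree (Polynomial.monom 1 p * prod_except gs k) < total_degree gs"
proof -
  have "Polynomial.degree (Polynomial.monom 1 p * prod_except gs k) \<le> p + Polynomial.degree (prod_except gs k)"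
    using degree_mult_le[of "Polynomial.monom 1 p" "prod_except gs k"]
    by (meson add_mono_thms_linordered_semiring(3) degree_monom_le le_trans)
  then show ?thesis using assms degree_prod_except_le[of k gs] by auto
qed

lemma degree_less_poly_sum:
  fixes P :: "'a::comm_semiring_1 poly"
  assumes "Polynomial.degree P < N"
  shows "poly P x = (\<Sum>q<N. Polynomial.coeff P q * x ^ q)"
  unfolding poly_altdef using assms
  by (intro sum.mono_neutral_left) (auto simp: coeff_eq_0)

subsection \<open>Resultant and discriminant in terms of roots\<close>

text \<open>The value of the resultant when \<open>a\<close> lists the roots of the monic factors;
  taking the root of the earlier block first fixes the sign.\<close>

definition block_cross :: "(nat \<times> nat) set \<Rightarrow> (nat \<times> nat \<Rightarrow> 'a::comm_ring_1) \<Rightarrow> 'a" where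
  "block_cross S a = (\<Prod>x\<in>S. \<Prod>y\<in>S. if fst x < fst y then a x - a y else 1)"

text \<open>The Vandermonde factor stays on both sides because it vanishes when roots coincide; it
  is cancelled once the discriminant is known to be nonzero.\<close>

lemma gen_resultant_vandermonde:
  fixes gs :: "'a::idom poly list" and a :: "nat \<times> nat \<Rightarrow> 'a"
  defines "S \<equiv> positions gs"
  assumes split: "\<And>k. k < length gs \<Longrightarrow> gs ! k = (\<Prod>p<Polynomial.degree (gs ! k). [:- a (k, p), 1:])"
  shows "gen_resultant gs * (\<Prod>x\<in>S. \<Prod>y\<in>S. if block_less y x then a x - a y else 1) =
    (\<Prod>x\<in>S. \<Prod>y\<in>S. if block_less y x then a x - a y else 1) * block_cross S a"
proof -
  define N where "N = total_degree gs"
  define \<rho> where "\<rho> = row_pos gs"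
  define m where "m k = Polynomial.degree (gs ! k)" for k
  \<comment> \<open>\<open>P (k, p)\<close> is the Newton basis polynomial formed from the first p
    roots of block k; \<open>U\<close> is the block-diagonal change of basis from the powers of
    X.\<close>
  define P where "P = (\<lambda>(k, p). \<Prod>i<p. [:- a (k, i), 1:])"
  define U where "U = mat N N (\<lambda>(r, r').
    if fst (\<rho> r) = fst (\<rho> r') then Polynomial.coeff (P (\<rho> r)) (snd (\<rho> r')) else 0)"
  \<comment> \<open>Column c holds the powers of root c, so multiplication by \<open>V\<close>
    evaluates every row polynomial at every root.\<close>
  define V where "V = mat N N (\<lambda>(q, c). a (\<rho> c) ^ q)"
  define M where "M = gen_sylvester_mat gs"
  define W where "W = mat N N (\<lambda>(r, c). poly (P (\<rho> r)) (a (\<rho> c)) * poly (prod_except gs (fst (\<rho> r))) (a (\<rho> c)))"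
  have carrier: "U \<in> carrier_mat N N" "V \<in> carrier_mat N N" "W \<in> carrier_mat N N" "M \<in> carrier_mat N N"
    using gen_sylvester_mat_carrier[of gs] by (simp_all add: U_def V_def W_def M_def N_def)
  have S: "S = (SIGMA k:{..<length gs}. {..<m k})" by (simp add: S_def m_def)
  have finS: "finite S" by (simp add: S)
  have \<rho>S: "\<rho> r \<in> S" if "r < N" for r
    using that row_pos_in_positions by (simp add: S_def \<rho>_def N_def)
  have \<rho>less: "block_less (\<rho> i) (\<rho> j) \<longleftrightarrow> i < j" if "i < N" "j < N" for i j
    using that unfolding \<rho>_def N_def by (intro row_index_less_iff) (simp_all add: length_row_index)
  have sumS: "(\<Sum>r<N. h (\<rho> r)) = sum h S" for h :: "nat \<times> nat \<Rightarrow> 'a"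
    unfolding N_def \<rho>_def S_def by (rule sum_row_index)
  have prodS: "(\<Prod>r<N. h (\<rho> r)) = prod h S" for h :: "nat \<times> nat \<Rightarrow> 'a"
    unfolding N_def \<rho>_def S_def by (rule prod_row_index)
  have Sprod: "prod h S = (\<Prod>k<length gs. \<Prod>p<m k. h (k, p))" for h :: "nat \<times> nat \<Rightarrow> 'a"
    by (simp add: S prod.Sigma)
  have degP: "Polynomial.degree (P x) = snd x" "lead_coeff (P x) = 1" for x
    unfolding P_def split_def lead_coeff_prod by (simp_all add: degree_prod_sum_eq)
  have MV: "M * V = mat N N (\<lambda>(r, c). a (\<rho> c) ^ snd (\<rho> r) * poly (prod_except gs (fst (\<rho> r))) (a (\<rho> c)))"
  proof (rule eq_matI)
    fix r c assume "r < dim_row (mat N N (\<lambda>(r, c). a (\<rho> c) ^ snd (\<rho> r) * poly (prod_except gs (fst (\<rho> r))) (a (\<rho> c))))"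
      and "c < dim_col (mat N N (\<lambda>(r, c). a (\<rho> c) ^ snd (\<rho> r) * poly (prod_except gs (fst (\<rho> r))) (a (\<rho> c))))"
    then have rc: "r < N" "c < N" by simp_all
    obtain k p where kp: "\<rho> r = (k, p)" by force
    have "(M * V) $$ (r, c) = (\<Sum>q<N. Polynomial.coeff (Polynomial.monom 1 p * prod_except gs k) q * a (\<rho> c) ^ q)"
      using rc carrier kp
      by (simp add: M_def gen_sylvester_mat_eq V_def scalar_prod_def atLeast0LessThan \<rho>_def N_def)
    also have "\<dots> = poly (Polynomial.monom 1 p * prod_except gs k) (a (\<rho> c))"
      using degree_sylvester_row[of k p gs] \<rho>S[OF rc(1)] kp
      by (intro degree_less_poly_sum[symmetric]) (simp add: N_def S_def)
    finally show "(M * V) $$ (r, c) = mat N N (\<lambda>(r, c). a (\<rho> c) ^ snd (\<rho> r) * poly (prod_except gs (fst (\<rho> r))) (a (\<rho> c))) $$ (r, c)"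
      using rc kp by (simp add: poly_monom)
  qed (use carrier in auto)
  have UMV: "U * (M * V) = W"
  proof (rule eq_matI)
    fix r c assume "r < dim_row W" "c < dim_col W"
    then have rc: "r < N" "c < N" by (simp_all add: W_def)
    obtain k p where kp: "\<rho> r = (k, p)" by force
    have k: "k < length gs" "p < m k" using \<rho>S[OF rc(1)] kp by (simp_all add: S)
    let ?G = "poly (prod_except gs k) (a (\<rho> c))"
    have "(U * (M * V)) $$ (r, c) = (\<Sum>r'<N. (if k = fst (\<rho> r') then Polynomial.coeff (P (k, p)) (snd (\<rho> r')) *
         (a (\<rho> c) ^ snd (\<rho> r') * poly (prod_except gs (fst (\<rho> r'))) (a (\<rho> c))) else 0))"
      unfolding MV using rc carrier kp
      by (auto simp: U_def scalar_prod_def atLeast0LessThan intro!: sum.cong)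
    also have "\<dots> = (\<Sum>k'<length gs. \<Sum>p'<m k'. if k = k' then Polynomial.coeff (P (k, p)) p' *
         (a (\<rho> c) ^ p' * poly (prod_except gs k') (a (\<rho> c))) else 0)"
      by (subst sumS) (simp add: S sum.Sigma split_def)
    also have "\<dots> = (\<Sum>k'<length gs. if k = k' then (\<Sum>p'<m k'. Polynomial.coeff (P (k, p)) p' *
         (a (\<rho> c) ^ p' * poly (prod_except gs k') (a (\<rho> c)))) else 0)"
      by (intro sum.cong) auto
    also have "\<dots> = (\<Sum>p'<m k. Polynomial.coeff (P (k, p)) p' * a (\<rho> c) ^ p') * ?G"
      using k by (simp add: sum.delta' sum_distrib_right mult.assoc)
    also have "\<dots> = poly (P (k, p)) (a (\<rho> c)) * ?G"
      using degree_less_poly_sum[of "P (k, p)" "m k"] degP k by simp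
    finally show "(U * (M * V)) $$ (r, c) = W $$ (r, c)"
      using rc kp by (simp add: W_def)
  qed (use carrier in auto)
  \<comment> \<open>\<open>U\<close> is lower triangular because \<open>P (k, p)\<close> has degree
    p, with diagonal 1 because it is monic.\<close>
  have "Determinant.det U = prod_list (diag_mat U)"
  proof (rule det_lower_triangular[OF _ carrier(1)])
    fix i j assume ij: "i < j" "j < N"
    then have "block_less (\<rho> i) (\<rho> j)" using \<rho>less by simp
    then show "U $$ (i, j) = 0"
      using ij degP[of "\<rho> i"] by (auto simp: U_def block_less_def coeff_eq_0)
  qed
  also have "\<dots> = (\<Prod>r<N. Polynomial.coeff (P (\<rho> r)) (snd (\<rho> r)))"
    by (simp add: prod_list_diag_prod U_def atLeast0LessThan)
  also have "\<dots> = 1" using degP by (intro prod.neutral) metis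
  finally have detU: "Determinant.det U = 1" .
  have "V = transpose_mat (mat N N (\<lambda>(i, q). a (\<rho> i) ^ q))"
    by (rule eq_matI) (auto simp: V_def)
  then have "Determinant.det V = Determinant.det (mat N N (\<lambda>(i, q). a (\<rho> i) ^ q))"
    by (simp add: det_transpose[of _ N])
  also have "\<dots> = (\<Prod>j<N. \<Prod>i<j. a (\<rho> j) - a (\<rho> i))"
  proof -
    have "mat N N (\<lambda>(i, q). a (\<rho> i) ^ q) = mat N N (\<lambda>(i, q). map (\<lambda>i. a (\<rho> i)) [0..<N] ! i ^ q)"
      by (rule eq_matI) auto
    then show ?thesis using det_vandermonde[of "map (\<lambda>i. a (\<rho> i)) [0..<N]"] by simp
  qed
  also have "\<dots> = (\<Prod>j<N. \<Prod>y\<in>S. if block_less y (\<rho> j) then a (\<rho> j) - a y else 1)"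
    unfolding \<rho>_def S_def N_def by (intro prod.cong prod_row_index_less) auto
  also have "\<dots> = (\<Prod>x\<in>S. \<Prod>y\<in>S. if block_less y x then a x - a y else 1)"
    by (rule prodS)
  finally have detV: "Determinant.det V = (\<Prod>x\<in>S. \<Prod>y\<in>S. if block_less y x then a x - a y else 1)" .
  \<comment> \<open>Both evaluations are written as products over all positions with an indicator,
    ready for comparison with the Vandermonde product.\<close>
  have polyP: "poly (P x) t = (\<Prod>y\<in>S. if fst y = fst x \<and> snd y < snd x then t - a y else 1)" if "x \<in> S" for x t
  proof -
    obtain k p where x: "x = (k, p)" by force
    then have k: "k < length gs" "p < m k" using that by (simp_all add: S)
    have "(\<Prod>y\<in>S. if fst y = fst x \<and> snd y < snd x then t - a y else 1) =
        (\<Prod>k'<length gs. \<Prod>p'<m k'. if k' = k \<and> p' < p then t - a (k', p') else 1)"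
      unfolding Sprod by (simp add: x)
    also have "\<dots> = (\<Prod>k'<length gs. if k' = k then \<Prod>p'<m k. if p' < p then t - a (k, p') else 1 else 1)"
      by (intro prod.cong) auto
    also have "\<dots> = (\<Prod>p'<m k. if p' < p then t - a (k, p') else 1)"
      using k by (simp add: prod.delta')
    also have "\<dots> = (\<Prod>p'<p. t - a (k, p'))"
      using k by (intro prod.mono_neutral_cong_right) auto
    finally show ?thesis by (simp add: x P_def poly_prod)
  qed
  have polyG: "poly (prod_except gs k) t = (\<Prod>y\<in>S. if fst y \<noteq> k then t - a y else 1)" for k t
  proof -
    have "(\<Prod>y\<in>S. if fst y \<noteq> k then t - a y else 1) =
        (\<Prod>k'<length gs. \<Prod>p'<m k'. if k' \<noteq> k then t - a (k', p') else 1)"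
      unfolding Sprod by simp
    also have "\<dots> = (\<Prod>k'<length gs. if k' \<noteq> k then poly (gs ! k') t else 1)"
    proof (rule prod.cong)
      fix k' assume "k' \<in> {..<length gs}"
      then have "poly (gs ! k') t = (\<Prod>p'<m k'. t - a (k', p'))"
        by (subst split) (simp_all add: poly_prod m_def)
      then show "(\<Prod>p'<m k'. if k' \<noteq> k then t - a (k', p') else 1) = (if k' \<noteq> k then poly (gs ! k') t else 1)"
        by simp
    qed simp
    also have "\<dots> = (\<Prod>j\<in>{..<length gs} - {k}. poly (gs ! j) t)"
      by (intro prod.mono_neutral_cong_right) auto
    finally show ?thesis by (simp add: prod_except_def poly_prod)
  qed
  have "Determinant.det W = prod_list (diag_mat W)"
  proof (rule det_upper_triangular[OF _ carrier(3)])
    show "upper_triangular W"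
      unfolding upper_triangular_def
    proof (intro allI impI)
      fix i j assume ij: "i < dim_row W" "j < i"
      then have ij: "i < N" "j < N" "j < i" by (simp_all add: W_def)
      then have "block_less (\<rho> j) (\<rho> i)" using \<rho>less by simp
      \<comment> \<open>The root of an earlier row annihilates the product of the other factors if
        it belongs to another block, and the Newton polynomial if it belongs to the same
        block.\<close>
      then consider "fst (\<rho> j) \<noteq> fst (\<rho> i)" | "fst (\<rho> j) = fst (\<rho> i)" "snd (\<rho> j) < snd (\<rho> i)"
        by (auto simp: block_less_def)
      then show "W $$ (i, j) = 0"
      proof cases
        case 1
        then have "poly (prod_except gs (fst (\<rho> i))) (a (\<rho> j)) = 0"
          unfolding polyG using finS \<rho>S[OF ij(2)] by (intro prod_zero) (auto intro!: bexI[of _ "\<rho> j"])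
        then show ?thesis using ij by (simp add: W_def)
      next
        case 2
        then have "poly (P (\<rho> i)) (a (\<rho> j)) = 0"
          unfolding polyP[OF \<rho>S[OF ij(1)]] using finS \<rho>S[OF ij(2)] by (intro prod_zero) (auto intro!: bexI[of _ "\<rho> j"])
        then show ?thesis using ij by (simp add: W_def)
      qed
    qed
  qed
  also have "\<dots> = (\<Prod>r<N. poly (P (\<rho> r)) (a (\<rho> r)) * poly (prod_except gs (fst (\<rho> r))) (a (\<rho> r)))"
    by (simp add: prod_list_diag_prod W_def atLeast0LessThan)
  also have "\<dots> = (\<Prod>x\<in>S. poly (P x) (a x) * poly (prod_except gs (fst x)) (a x))"
    by (rule prodS)
  \<comment> \<open>Earlier positions, in the same block through \<open>P\<close> and in earlier
    blocks through \<open>prod_except\<close>, form the Vandermonde product; later blocks form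
    \<open>block_cross\<close>.\<close>
  also have "\<dots> = (\<Prod>x\<in>S. (\<Prod>y\<in>S. if block_less y x then a x - a y else 1) *
      (\<Prod>y\<in>S. if fst x < fst y then a x - a y else 1))"
    by (intro prod.cong refl)
      (auto simp: polyP polyG block_less_def simp flip: prod.distrib intro!: prod.cong)
  finally have "Determinant.det W = Determinant.det V * block_cross S a"
    by (simp add: detV block_cross_def prod.distrib)
  moreover have "Determinant.det W = Determinant.det U * (Determinant.det M * Determinant.det V)"
    unfolding UMV[symmetric] using carrier by (simp add: det_mult[of _ N])
  ultimately show ?thesis by (simp add: detU detV gen_resultant_def M_def)
qed

text \<open>Each pair of positions lies either in two blocks, contributing to the squared cross
  product, or in one block, contributing to that block's discriminant.\<close>

lemma root_discriminant_blocks: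
  fixes a :: "nat \<times> nat \<Rightarrow> 'a::comm_ring_1"
  defines "S \<equiv> \<lambda>m n. SIGMA k:{..<n}. {..<m k}"
  shows "root_discriminant (map a (row_index m n)) =
    (block_cross (S m n) a)\<^sup>2 * (\<Prod>k<n. root_discriminant (map (\<lambda>p. a (k, p)) [0..<m k]))"
proof -
  let ?S = "S m n" and ?L = "row_index m n"
  have Sprod: "prod h ?S = (\<Prod>k<n. \<Prod>p<m k. h (k, p))" for h :: "nat \<times> nat \<Rightarrow> 'a"
    by (simp add: S_def prod.Sigma)
  have "root_discriminant (map a ?L) = (\<Prod>j<(\<Sum>k<n. m k). \<Prod>i<j. (a (?L ! i) - a (?L ! j))\<^sup>2)"
    by (simp add: root_discriminant_def length_row_index)
  also have "\<dots> = (\<Prod>j<(\<Sum>k<n. m k). \<Prod>y\<in>?S. if block_less y (?L ! j) then (a y - a (?L ! j))\<^sup>2 else 1)"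
    unfolding S_def by (intro prod.cong prod_row_index_less) auto
  also have "\<dots> = (\<Prod>x\<in>?S. \<Prod>y\<in>?S. if block_less y x then (a y - a x)\<^sup>2 else 1)"
    unfolding S_def by (rule prod_row_index)
  also have "\<dots> = (\<Prod>x\<in>?S. \<Prod>y\<in>?S. (if fst y < fst x then (a y - a x)\<^sup>2 else 1) *
      (if fst y = fst x \<and> snd y < snd x then (a y - a x)\<^sup>2 else 1))"
    by (intro prod.cong) (auto simp: block_less_def)
  also have "\<dots> = (\<Prod>x\<in>?S. \<Prod>y\<in>?S. if fst y < fst x then (a y - a x)\<^sup>2 else 1) *
      (\<Prod>x\<in>?S. \<Prod>y\<in>?S. if fst y = fst x \<and> snd y < snd x then (a y - a x)\<^sup>2 else 1)"
    by (simp add: prod.distrib)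
  \<comment> \<open>\<open>block_cross\<close> names the earlier position first, so the two products
    are exchanged.\<close>
  also have "(\<Prod>x\<in>?S. \<Prod>y\<in>?S. if fst y < fst x then (a y - a x)\<^sup>2 else 1) = (block_cross ?S a)\<^sup>2"
    unfolding block_cross_def
    by (subst prod.swap) (simp add: prod_power_distrib if_distrib[of "\<lambda>x. x\<^sup>2"] cong: if_cong)
  also have "(\<Prod>x\<in>?S. \<Prod>y\<in>?S. if fst y = fst x \<and> snd y < snd x then (a y - a x)\<^sup>2 else 1) =
      (\<Prod>k<n. \<Prod>p<m k. \<Prod>i<p. (a (k, i) - a (k, p))\<^sup>2)"
    unfolding Sprod
  proof (rule prod.cong[OF refl], rule prod.cong[OF refl])
    fix k p assume kp: "k \<in> {..<n}" "p \<in> {..<m k}"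
    have "(\<Prod>k'<n. \<Prod>p'<m k'. if fst (k', p') = fst (k, p) \<and> snd (k', p') < snd (k, p)
        then (a (k', p') - a (k, p))\<^sup>2 else 1) =
      (\<Prod>k'<n. if k' = k then \<Prod>p'<m k. if p' < p then (a (k, p') - a (k, p))\<^sup>2 else 1 else 1)"
      by (intro prod.cong) auto
    also have "\<dots> = (\<Prod>p'<m k. if p' < p then (a (k, p') - a (k, p))\<^sup>2 else 1)"
      using kp by (simp add: prod.delta')
    also have "\<dots> = (\<Prod>i<p. (a (k, i) - a (k, p))\<^sup>2)"
      using kp by (intro prod.mono_neutral_cong_right) auto
    finally show "(\<Prod>k'<n. \<Prod>p'<m k'. if fst (k', p') = fst (k, p) \<and> snd (k', p') < snd (k, p)
        then (a (k', p') - a (k, p))\<^sup>2 else 1) = (\<Prod>i<p. (a (k, i) - a (k, p))\<^sup>2)" .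
  qed
  finally show ?thesis by (simp add: root_discriminant_def)
qed

section \<open>Descent from the algebraic closure to the coefficient domain\<close>

lemma map_poly_embed_ac_mult:
  "map_poly embed_ac (f * g) = map_poly embed_ac f * map_poly embed_ac g"
proof -
  interpret inj_comm_ring_hom "embed_ac :: 'a \<Rightarrow> _" by (rule embed_ac_hom)
  show ?thesis by (rule poly_eqI) (simp add: coeff_mult hom_distribs)
qed

lemma map_poly_embed_ac_prod:
  "map_poly embed_ac (prod f A) = (\<Prod>x\<in>A. map_poly embed_ac (f x))"
  by (induction A rule: infinite_finite_induct) (simp_all add: map_poly_embed_ac_mult)

text \<open>The embedding is injective, so degrees, matrix size and row positions are preserved;
  ring homomorphisms commute with determinants.\<close>

lemma embed_gen_resultant:
  fixes gs :: "'a::idom poly list"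
  shows "embed_ac (gen_resultant gs) = gen_resultant (map (map_poly embed_ac) gs)"
proof -
  interpret inj_comm_ring_hom "embed_ac :: 'a \<Rightarrow> _" by (rule embed_ac_hom)
  let ?hs = "map (map_poly embed_ac) gs"
  have deg: "total_degree ?hs = total_degree gs" by simp
  have pos: "row_pos ?hs = row_pos gs"
    unfolding row_index_def by (intro ext arg_cong2[of _ _ _ _ "(!)"] arg_cong[of _ _ concat] map_cong) simp_all
  have ex: "prod_except ?hs k = map_poly embed_ac (prod_except gs k)" for k
    by (simp add: prod_except_def map_poly_embed_ac_prod)
  have "gen_sylvester_mat ?hs = map_mat embed_ac (gen_sylvester_mat gs)"
    unfolding gen_sylvester_mat_eq deg pos ex
    by (rule eq_matI) (auto simp: coeff_monom_mult)
  then show ?thesis using hom_det[of "gen_sylvester_mat gs"] by (simp add: gen_resultant_def)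
qed

text \<open>In the algebraic closure the discriminant of the product is the squared resultant times
  the discriminants of the factors. All these come from the domain, so injectivity brings the
  identity down.\<close>

lemma gen_resultant_square_dvd_discriminant:
  fixes gs :: "'a::idom poly list"
  assumes monic: "\<And>k. k < length gs \<Longrightarrow> lead_coeff (gs ! k) = 1"
    and nonzero: "discriminant (\<Prod>k<length gs. gs ! k) \<noteq> 0"
  shows "(gen_resultant gs)\<^sup>2 dvd discriminant (\<Prod>k<length gs. gs ! k)"
proof -
  interpret inj_comm_ring_hom "embed_ac :: 'a \<Rightarrow> _" by (rule embed_ac_hom)
  let ?n = "length gs" and ?G = "\<Prod>k<length gs. gs ! k"
  define hs where "hs = map (map_poly embed_ac) gs"
  define m where "m k = Polynomial.degree (gs ! k)" for k
  obtain \<alpha>s where \<alpha>s: "\<And>k. k < ?n \<Longrightarrow> splitting_roots (gs ! k) (\<alpha>s k)"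
    using splitting_roots_exist[OF monic] by metis
  define a where "a = (\<lambda>(k, p). \<alpha>s k ! p)"
  have len: "length (\<alpha>s k) = m k" if "k < ?n" for k
    using splitting_roots_length[OF \<alpha>s[OF that]] by (simp add: m_def)
  have split: "map_poly embed_ac (gs ! k) = (\<Prod>p<m k. [:- a (k, p), 1:])" if "k < ?n" for k
    using \<alpha>s[OF that] len[OF that]
    by (simp add: splitting_roots_def prod.list_conv_set_nth a_def atLeast0LessThan)
  have roots: "map (\<lambda>p. a (k, p)) [0..<m k] = \<alpha>s k" if "k < ?n" for k
    using len[OF that] by (intro nth_equalityI) (simp_all add: a_def)
  let ?S = "SIGMA k:{..<?n}. {..<m k}"
  let ?as = "map a (row_index m ?n)"
  have "splitting_roots ?G ?as"
  proof -
    have "map_poly embed_ac ?G = (\<Prod>k<?n. \<Prod>p<m k. [:- a (k, p), 1:])"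
      by (simp add: map_poly_embed_ac_prod split)
    also have "\<dots> = (\<Prod>x\<in>?S. [:- a x, 1:])" by (simp add: prod.Sigma)
    also have "\<dots> = (\<Prod>r<(\<Sum>k<?n. m k). [:- a (row_index m ?n ! r), 1:])"
      by (rule prod_row_index[symmetric])
    also have "\<dots> = (\<Prod>\<alpha>\<leftarrow>?as. [:-\<alpha>, 1:])"
      by (simp add: prod.list_conv_set_nth length_row_index atLeast0LessThan)
    finally show ?thesis by (simp add: splitting_roots_def)
  qed
  moreover have "lead_coeff ?G = 1" by (simp add: lead_coeff_prod monic)
  ultimately have "embed_ac (discriminant ?G) = root_discriminant ?as" by (metis embed_discriminant)
  also have "\<dots> = (block_cross ?S a)\<^sup>2 * (\<Prod>k<?n. root_discriminant (map (\<lambda>p. a (k, p)) [0..<m k]))"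
    by (rule root_discriminant_blocks)
  also have "(\<Prod>k<?n. root_discriminant (map (\<lambda>p. a (k, p)) [0..<m k])) = embed_ac (\<Prod>k<?n. discriminant (gs ! k))"
    unfolding hom_prod using \<alpha>s monic by (intro prod.cong) (auto simp: roots intro!: embed_discriminant[symmetric])
  finally have disc: "embed_ac (discriminant ?G) =
    (block_cross ?S a)\<^sup>2 * embed_ac (\<Prod>k<?n. discriminant (gs ! k))" .
  let ?V = "\<Prod>x\<in>?S. \<Prod>y\<in>?S. if block_less y x then a x - a y else 1"
  \<comment> \<open>The Vandermonde factor squares to the nonzero discriminant and can therefore be
    cancelled.\<close>
  have "?V\<^sup>2 = root_discriminant ?as"
  proof -
    have "root_discriminant ?as = (\<Prod>j<(\<Sum>k<?n. m k). \<Prod>i<j. (a (row_index m ?n ! j) - a (row_index m ?n ! i))\<^sup>2)"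
      by (simp add: root_discriminant_def length_row_index power2_commute)
    also have "\<dots> = (\<Prod>j<(\<Sum>k<?n. m k). \<Prod>y\<in>?S. if block_less y (row_index m ?n ! j)
        then (a (row_index m ?n ! j) - a y)\<^sup>2 else 1)"
      by (intro prod.cong prod_row_index_less) auto
    also have "\<dots> = (\<Prod>x\<in>?S. \<Prod>y\<in>?S. if block_less y x then (a x - a y)\<^sup>2 else 1)"
      by (rule prod_row_index)
    finally show ?thesis
      by (simp add: prod_power_distrib if_distrib[of "\<lambda>x. x\<^sup>2"] cong: if_cong)
  qed
  then have "?V \<noteq> 0"
    using nonzero \<open>embed_ac (discriminant ?G) = root_discriminant ?as\<close> by fastforce
  have "hs ! k = (\<Prod>p<Polynomial.degree (hs ! k). [:- a (k, p), 1:])" if "k < length hs" for k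
  proof -
    have "k < ?n" using that by (simp add: hs_def)
    then have "hs ! k = map_poly embed_ac (gs ! k)" by (simp add: hs_def)
    also have "\<dots> = (\<Prod>p<m k. [:- a (k, p), 1:])" by (rule split) fact
    also have "m k = Polynomial.degree (hs ! k)" using \<open>k < ?n\<close> by (simp add: hs_def m_def)
    finally show ?thesis .
  qed
  moreover have "positions hs = ?S" by (auto simp: hs_def m_def)
  ultimately have "gen_resultant hs * ?V = ?V * block_cross ?S a"
    using gen_resultant_vandermonde[of hs a] by simp
  then have "?V * gen_resultant hs = ?V * block_cross ?S a" by (simp only: mult.commute)
  then have "gen_resultant hs = block_cross ?S a"
    using \<open>?V \<noteq> 0\<close> mult_left_cancel by blast
  then have "embed_ac (discriminant ?G) =
      embed_ac ((gen_resultant gs)\<^sup>2 * (\<Prod>k<?n. discriminant (gs ! k)))"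
    using disc by (simp add: embed_gen_resultant hs_def hom_distribs)
  then have "discriminant ?G = (gen_resultant gs)\<^sup>2 * (\<Prod>k<?n. discriminant (gs ! k))"
    by (rule injectivity)
  then show ?thesis by simp
qed

section \<open>Newton's identities and congruence of discriminants\<close>

lemma power_sum_recurrence:
  fixes f :: "'a::idom poly"
  assumes "lead_coeff f = 1" and r: "splitting_roots f \<alpha>s"
    and q: "\<And>i. embed_ac (q i) = (\<Sum>\<alpha>\<leftarrow>\<alpha>s. \<alpha> ^ i)"
  defines "c \<equiv> Polynomial.coeff (reflect_poly f)"
  shows "q k = of_nat (Polynomial.degree f) * c k - of_nat k * c k - (\<Sum>i<k. q i * c (k - i))"
proof -
  interpret inj_comm_ring_hom "embed_ac :: 'a \<Rightarrow> _" by (rule embed_ac_hom)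
  define F where "F = fps_of_poly (reflect_poly (\<Prod>\<alpha>\<leftarrow>\<alpha>s. [:-\<alpha>, 1:]))"
  have F: "fps_nth F i = embed_ac (c i)" for i
    by (simp add: F_def c_def coeff_reflect_poly flip: r[unfolded splitting_roots_def])
  have "(\<Sum>i\<le>k. embed_ac (q i) * fps_nth F (k - i)) =
      fps_nth (Abs_fps (\<lambda>k. \<Sum>\<alpha>\<leftarrow>\<alpha>s. \<alpha> ^ k) * F) k"
    by (simp add: fps_mult_nth atMost_atLeast0 q)
  also have "\<dots> = fps_nth (fps_const (of_nat (length \<alpha>s)) * F - fps_X * fps_deriv F) k"
    using fps_power_sums[of \<alpha>s, folded F_def] by (simp only: fps_of_nat)
  also have "\<dots> = of_nat (length \<alpha>s) * fps_nth F k - of_nat k * fps_nth F k"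
    unfolding fps_sub_nth fps_mult_left_const_nth
    by (cases k) (simp_all add: fps_X_mult_nth)
  \<comment> \<open>The term i = k is split off. Its factor \<open>c 0\<close> is the leading
    coefficient 1, so \<open>q k\<close> is obtained without any division.\<close>
  finally have "(\<Sum>i<k. embed_ac (q i) * embed_ac (c (k - i))) + embed_ac (q k) * embed_ac (c 0) =
      of_nat (Polynomial.degree f) * embed_ac (c k) - of_nat k * embed_ac (c k)"
    by (simp add: F splitting_roots_length[OF r] flip: lessThan_Suc_atMost)
  then have "embed_ac ((\<Sum>i<k. q i * c (k - i)) + q k) =
      embed_ac (of_nat (Polynomial.degree f) * c k - of_nat k * c k)"
    using assms(1) by (simp add: hom_distribs c_def)
  then have "(\<Sum>i<k. q i * c (k - i)) + q k = of_nat (Polynomial.degree f) * c k - of_nat k * c k"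
    by (rule injectivity)
  then show ?thesis by (simp add: algebra_simps)
qed

text \<open>The Hankel matrix of the power sums is the Vandermonde matrix of the roots multiplied on
  the left by its transpose.\<close>

lemma discriminant_eq_det:
  fixes f :: "'a::idom poly"
  assumes "lead_coeff f = 1" and r: "splitting_roots f \<alpha>s"
    and q: "\<And>i. embed_ac (q i) = (\<Sum>\<alpha>\<leftarrow>\<alpha>s. \<alpha> ^ i)"
  shows "discriminant f = Determinant.det (mat (Polynomial.degree f) (Polynomial.degree f) (\<lambda>(i, j). q (i + j)))"
proof -
  interpret inj_comm_ring_hom "embed_ac :: 'a \<Rightarrow> _" by (rule embed_ac_hom)
  define M where "M = mat (Polynomial.degree f) (Polynomial.degree f) (\<lambda>(i, j). q (i + j))"
  have "map_mat embed_ac M = mat (length \<alpha>s) (length \<alpha>s) (\<lambda>(i, j). \<Sum>\<alpha>\<leftarrow>\<alpha>s. \<alpha> ^ (i + j))"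
    by (rule eq_matI) (auto simp: M_def splitting_roots_length[OF r] q)
  then have "embed_ac (Determinant.det M) = embed_ac (discriminant f)"
    using hom_det[of M] embed_discriminant[OF assms(1) r] by (simp add: det_power_sums)
  then show ?thesis unfolding M_def by (metis injectivity)
qed

text \<open>The roots of \<open>f\<close> and \<open>g\<close> cannot be compared one by one.
  Newton's recursion, however, has integer coefficients, so the power sums are congruent, and with
  them their Hankel determinants.\<close>

lemma discriminant_cong:
  fixes f g :: "'a::idom poly"
  assumes f: "lead_coeff f = 1" and g: "lead_coeff g = 1"
    and deg: "Polynomial.degree f = Polynomial.degree g" and cong: "[:u:] dvd f - g"
  shows "u dvd discriminant f - discriminant g"
proof -
  obtain \<alpha>s \<beta>s where \<alpha>s: "splitting_roots f \<alpha>s" and \<beta>s: "splitting_roots g \<beta>s"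
    using splitting_roots_exist f g by metis
  obtain p where p: "\<And>i. embed_ac (p i) = (\<Sum>\<alpha>\<leftarrow>\<alpha>s. \<alpha> ^ i)"
    using power_sums_in_domain[OF f] \<alpha>s by metis
  obtain q where q: "\<And>i. embed_ac (q i) = (\<Sum>\<alpha>\<leftarrow>\<beta>s. \<alpha> ^ i)"
    using power_sums_in_domain[OF g] \<beta>s by metis
  \<comment> \<open>Equality of degrees aligns the reflected coefficients.\<close>
  have c: "u dvd Polynomial.coeff (reflect_poly f) i - Polynomial.coeff (reflect_poly g) i" for i
    using cong deg by (simp add: coeff_reflect_poly const_poly_dvd_diff_iff)
  have "u dvd p k - q k" for k
  proof (induction k rule: less_induct)
    case (less k)
    let ?c = "Polynomial.coeff (reflect_poly f)" and ?d = "Polynomial.coeff (reflect_poly g)"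
    let ?n = "of_nat (Polynomial.degree g) :: 'a"
    have "u dvd (?n * ?c k - of_nat k * ?c k - (\<Sum>i<k. p i * ?c (k - i))) -
        (?n * ?d k - of_nat k * ?d k - (\<Sum>i<k. q i * ?d (k - i)))"
    proof -
      have "u dvd (\<Sum>i<k. p i * ?c (k - i)) - (\<Sum>i<k. q i * ?d (k - i))"
        using less c by (intro dvd_diff_sum dvd_diff_mult) auto
      moreover have "u dvd (?n - of_nat k) * (?c k - ?d k)" using c by simp
      ultimately have "u dvd (?n - of_nat k) * (?c k - ?d k) - ((\<Sum>i<k. p i * ?c (k - i)) - (\<Sum>i<k. q i * ?d (k - i)))"
        by (rule dvd_diff[rotated])
      then show ?thesis by (simp add: left_diff_distrib right_diff_distrib algebra_simps)
    qed
    then show ?case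
      using power_sum_recurrence[OF f \<alpha>s p, of k] power_sum_recurrence[OF g \<beta>s q, of k] deg by simp
  qed
  then show ?thesis
    unfolding discriminant_eq_det[OF f \<alpha>s p] discriminant_eq_det[OF g \<beta>s q] deg
    by (intro dvd_diff_det) auto
qed

subsection \<open>The linear map of the Sylvester matrix\<close>

text \<open>A linear combination of rows is the same combination of row polynomials. The transpose
  forms it, with the coefficients of all multipliers stacked into one vector.\<close>

lemma sylvester_transpose_mult_vec:
  fixes gs :: "'a::comm_ring_1 poly list"
  assumes "q < total_degree gs"
  shows "(transpose_mat (gen_sylvester_mat gs) *\<^sub>v vec (total_degree gs) (\<lambda>r. c (row_pos gs r))) $ q =
    Polynomial.coeff (\<Sum>k<length gs.
      (\<Sum>p<Polynomial.degree (gs ! k). Polynomial.monom (c (k, p)) p) * prod_except gs k) q"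
proof -
  let ?h = "\<lambda>x. Polynomial.coeff (Polynomial.monom 1 (snd x) * prod_except gs (fst x)) q * c x"
  have "(transpose_mat (gen_sylvester_mat gs) *\<^sub>v vec (total_degree gs) (\<lambda>r. c (row_pos gs r))) $ q =
      (\<Sum>r<total_degree gs. ?h (row_pos gs r))"
    using assms by (simp add: gen_sylvester_mat_eq scalar_prod_def atLeast0LessThan)
  also have "\<dots> = sum ?h (positions gs)" by (rule sum_row_index)
  also have "\<dots> = (\<Sum>k<length gs. \<Sum>p<Polynomial.degree (gs ! k). ?h (k, p))"
    by (simp add: sum.Sigma split_def)
  also have "\<dots> = (\<Sum>k<length gs. \<Sum>p<Polynomial.degree (gs ! k).
      Polynomial.coeff (Polynomial.monom (c (k, p)) p * prod_except gs k) q)"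
    by (intro sum.cong) (simp_all add: coeff_monom_mult mult.commute[of _ "c _"])
  finally show ?thesis by (simp add: sum_distrib_right coeff_sum)
qed

lemma adj_mat_mult_vec:
  assumes "A \<in> carrier_mat n n" "v \<in> carrier_vec n"
  shows "A *\<^sub>v (adj_mat A *\<^sub>v v) = Determinant.det A \<cdot>\<^sub>v v"
    and "adj_mat A *\<^sub>v (A *\<^sub>v v) = Determinant.det A \<cdot>\<^sub>v v"
proof -
  note adj = adj_mat[OF assms(1)]
  have "(Determinant.det A \<cdot>\<^sub>m 1\<^sub>m n) *\<^sub>v v = Determinant.det A \<cdot>\<^sub>v v"
    using assms(2) by (intro eq_vecI) auto
  then show "A *\<^sub>v (adj_mat A *\<^sub>v v) = Determinant.det A \<cdot>\<^sub>v v"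
    and "adj_mat A *\<^sub>v (A *\<^sub>v v) = Determinant.det A \<cdot>\<^sub>v v"
    using assms adj by (metis assoc_mult_mat_vec)+
qed

lemma transpose_sylvester:
  "transpose_mat (gen_sylvester_mat gs) \<in> carrier_mat (total_degree gs) (total_degree gs)"
  "Determinant.det (transpose_mat (gen_sylvester_mat gs)) = gen_resultant gs"
  using gen_sylvester_mat_carrier[of gs] by (auto simp: det_transpose gen_resultant_def)

lemma row_pos_surj:
  assumes "x \<in> positions gs"
  obtains r where "r < total_degree gs" "row_pos gs r = x"
proof -
  have "x \<in> row_pos gs ` {..<total_degree gs}"
    unfolding bij_betw_imp_surj_on[OF bij_betw_row_index] by (rule assms)
  then show ?thesis using that by auto
qed

lemma coeff_sum_monom:
  "Polynomial.coeff (\<Sum>p<m. Polynomial.monom (c p) p) i = (if i < m then c i else 0)"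
  by (simp add: coeff_sum sum.delta)

lemma poly_sum_monom:
  assumes "\<And>i. m \<le> i \<Longrightarrow> Polynomial.coeff u i = 0"
  shows "(\<Sum>p<m. Polynomial.monom (Polynomial.coeff u p) p) = u"
  using assms by (intro poly_eqI) (auto simp: coeff_sum_monom)

text \<open>The adjugate solves the linear system up to the determinant, so nothing has to be
  inverted in the ring.\<close>

lemma gen_resultant_bezout:
  fixes gs :: "'a::comm_ring_1 poly list"
  assumes b: "\<And>i. total_degree gs \<le> i \<Longrightarrow> Polynomial.coeff b i = 0"
  shows "\<exists>u. (\<forall>k. \<forall>i\<ge>Polynomial.degree (gs ! k). Polynomial.coeff (u k) i = 0) \<and>
    (\<Sum>k<length gs. u k * prod_except gs k) = Polynomial.smult (gen_resultant gs) b"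
proof -
  let ?N = "total_degree gs" and ?T = "transpose_mat (gen_sylvester_mat gs)"
  note T = transpose_sylvester[of gs]
  define w where "w = adj_mat ?T *\<^sub>v vec ?N (Polynomial.coeff b)"
  have w: "w \<in> carrier_vec ?N" using adj_mat(1)[OF T(1)] by (auto simp: w_def)
  \<comment> \<open>Reads the solution vector as a function of block and position by inverting the
    row numbering.\<close>
  have "\<exists>c. \<forall>r<?N. c (row_pos gs r) = w $ r"
  proof -
    have "inj_on (row_pos gs) {..<?N}" by (rule bij_betw_imp_inj_on[OF bij_betw_row_index])
    then show ?thesis
      by (intro exI[of _ "\<lambda>x. w $ the_inv_into {..<?N} (row_pos gs) x"]) (simp add: the_inv_into_f_f)
  qed
  then obtain c where c: "\<And>r. r < ?N \<Longrightarrow> c (row_pos gs r) = w $ r" by blast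
  define u where "u k = (\<Sum>p<Polynomial.degree (gs ! k). Polynomial.monom (c (k, p)) p)" for k
  have u: "Polynomial.coeff (u k) i = 0" if "Polynomial.degree (gs ! k) \<le> i" for k i
    using that by (simp add: u_def coeff_sum_monom)
  have "?T *\<^sub>v w = gen_resultant gs \<cdot>\<^sub>v vec ?N (Polynomial.coeff b)"
    using adj_mat_mult_vec(1)[OF T(1)] by (simp add: w_def T(2))
  moreover have "w = vec ?N (\<lambda>r. c (row_pos gs r))" using c w by (intro eq_vecI) auto
  ultimately have low: "Polynomial.coeff (\<Sum>k<length gs. u k * prod_except gs k) q =
      Polynomial.coeff (Polynomial.smult (gen_resultant gs) b) q" if "q < ?N" for q
    using sylvester_transpose_mult_vec[OF that, of c] that by (simp add: u_def)
  \<comment> \<open>The system governs only coefficients below N; from N on both sides vanish by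
    degree. A constant factor is treated apart: there \<open>u k = 0\<close>, but its degree is not
    strictly smaller.\<close>
  have "Polynomial.coeff (u k * prod_except gs k) q = 0" if "k < length gs" "?N \<le> q" for k q
  proof (cases "Polynomial.degree (gs ! k) = 0")
    case True
    then show ?thesis by (simp add: u_def)
  next
    case False
    then have "Polynomial.degree (u k) < Polynomial.degree (gs ! k)"
      using u[of k] by (intro degree_lessI) auto
    then show ?thesis
      using degree_mult_le[of "u k" "prod_except gs k"] degree_prod_except_le[OF that(1)] that(2)
      by (intro coeff_eq_0) linarith
  qed
  then have high: "Polynomial.coeff (\<Sum>k<length gs. u k * prod_except gs k) q =
      Polynomial.coeff (Polynomial.smult (gen_resultant gs) b) q" if "?N \<le> q" for q
    using that b by (simp add: coeff_sum)
  have "(\<Sum>k<length gs. u k * prod_except gs k) = Polynomial.smult (gen_resultant gs) b"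
    using low high by (intro poly_eqI) (meson not_less)
  with u show ?thesis by blast
qed

text \<open>The converse use of the adjugate: applied to a vector divisible by \<open>d\<close>, it
  recovers the multipliers times the resultant.\<close>

lemma gen_resultant_mult_dvd:
  fixes gs :: "'a::idom poly list"
  assumes u: "\<And>k i. k < length gs \<Longrightarrow> Polynomial.degree (gs ! k) \<le> i \<Longrightarrow> Polynomial.coeff (u k) i = 0"
    and dvd: "[:d:] dvd (\<Sum>k<length gs. u k * prod_except gs k)"
    and k: "k < length gs"
  shows "d dvd gen_resultant gs * Polynomial.coeff (u k) i"
proof (cases "i < Polynomial.degree (gs ! k)")
  case True
  let ?N = "total_degree gs" and ?T = "transpose_mat (gen_sylvester_mat gs)"
  note T = transpose_sylvester[of gs]
  define c where "c = (\<lambda>(k, p). Polynomial.coeff (u k) p)"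
  define v where "v = vec ?N (\<lambda>r. c (row_pos gs r))"
  obtain r where r: "r < ?N" "row_pos gs r = (k, i)"
    using row_pos_surj[of "(k, i)" gs] True k by auto
  have "(\<Sum>k<length gs. (\<Sum>p<Polynomial.degree (gs ! k). Polynomial.monom (c (k, p)) p) * prod_except gs k) =
      (\<Sum>k<length gs. u k * prod_except gs k)"
    using u by (intro sum.cong) (simp_all add: c_def poly_sum_monom)
  then have "d dvd (?T *\<^sub>v v) $ q" if "q < ?N" for q
    using sylvester_transpose_mult_vec[OF that, of c] dvd by (simp add: v_def const_poly_dvd_iff)
  then have "d dvd (adj_mat ?T *\<^sub>v (?T *\<^sub>v v)) $ r"
    using adj_mat(1)[OF T(1)] T(1) r by (auto simp: scalar_prod_def intro!: dvd_sum)
  moreover have "adj_mat ?T *\<^sub>v (?T *\<^sub>v v) = gen_resultant gs \<cdot>\<^sub>v v"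
    using adj_mat_mult_vec(2)[OF T(1)] by (simp add: v_def T(2))
  ultimately show ?thesis using r by (simp add: v_def c_def)
next
  case False
  then show ?thesis using u k by simp
qed

text \<open>Equal degrees give matrices of the same shape, whose entries are coefficients of
  congruent products.\<close>

lemma gen_resultant_cong:
  fixes gs hs :: "'a::idom poly list"
  assumes len: "length hs = length gs"
    and deg: "\<And>k. k < length gs \<Longrightarrow> Polynomial.degree (hs ! k) = Polynomial.degree (gs ! k)"
    and cong: "\<And>k. k < length gs \<Longrightarrow> [:d:] dvd hs ! k - gs ! k"
  shows "d dvd gen_resultant hs - gen_resultant gs"
proof -
  have N: "total_degree hs = total_degree gs" using len deg by simp
  have pos: "row_pos hs = row_pos gs"
    unfolding row_index_def len using deg
    by (intro ext arg_cong2[of _ _ _ _ "(!)"] arg_cong[of _ _ concat] map_cong) simp_all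
  have "[:d:] dvd Polynomial.monom 1 p * prod_except hs k - Polynomial.monom 1 p * prod_except gs k" for p k
    unfolding prod_except_def len using cong by (intro dvd_diff_mult dvd_diff_prod) auto
  then show ?thesis
    unfolding gen_resultant_def gen_sylvester_mat_eq N pos
    by (intro dvd_diff_det[where n = "total_degree gs"]) (simp_all add: const_poly_dvd_diff_iff)
qed

section \<open>First-order expansion of a perturbed product\<close>

lemma prod_add_mult_expansion:
  fixes d :: "'a::comm_ring_1"
  assumes "finite S"
  shows "d\<^sup>2 dvd (\<Prod>k\<in>S. g k + d * u k) - (\<Prod>k\<in>S. g k) - d * (\<Sum>k\<in>S. u k * (\<Prod>j\<in>S - {k}. g j))"
  using assms
proof (induction S)
  case (insert x S)
  let ?P = "\<Prod>k\<in>S. g k + d * u k" and ?Q = "\<Prod>k\<in>S. g k"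
  let ?R = "\<Sum>k\<in>S. u k * (\<Prod>j\<in>S - {k}. g j)"
  have "(\<Sum>k\<in>S. u k * (\<Prod>j\<in>insert x S - {k}. g j)) = g x * ?R"
    unfolding sum_distrib_left
  proof (rule sum.cong)
    fix k assume "k \<in> S"
    then have "insert x S - {k} = insert x (S - {k})" using insert by auto
    then show "u k * (\<Prod>j\<in>insert x S - {k}. g j) = g x * (u k * (\<Prod>j\<in>S - {k}. g j))"
      using insert by simp
  qed simp
  moreover have "insert x S - {x} = S" using insert by auto
  \<comment> \<open>The new error is the old error times the new factor, plus the product of the two
    first-order terms.\<close>
  ultimately have "(\<Prod>k\<in>insert x S. g k + d * u k) - (\<Prod>k\<in>insert x S. g k) -
      d * (\<Sum>k\<in>insert x S. u k * (\<Prod>j\<in>insert x S - {k}. g j)) =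
      (g x + d * u x) * (?P - ?Q - d * ?R) + d\<^sup>2 * (u x * ?R)"
    using insert by (simp add: algebra_simps power2_eq_square)
  then show ?case using insert by simp
qed simp

lemma monic_add:
  assumes "lead_coeff g = (1::'a::comm_ring_1)"
    and "\<And>i. Polynomial.degree g \<le> i \<Longrightarrow> Polynomial.coeff u i = 0"
  shows "lead_coeff (g + u) = 1"
proof -
  have "Polynomial.degree (g + u) = Polynomial.degree g"
  proof (rule antisym)
    show "Polynomial.degree (g + u) \<le> Polynomial.degree g"
      using assms(2) by (intro degree_le) (simp add: coeff_eq_0)
    show "Polynomial.degree g \<le> Polynomial.degree (g + u)"
      using assms by (intro le_degree) simp
  qed
  then show ?thesis using assms by simp
qed

subsection \<open>Hensel lifting\<close>

lemma const_poly_square_dvd_expansion: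
  fixes gs hs :: "'a::comm_ring_1 poly list"
  assumes "length hs = length gs"
    and "\<And>k. k < length gs \<Longrightarrow> hs ! k = gs ! k + Polynomial.smult d (u k)"
  shows "[:d\<^sup>2:] dvd (\<Prod>k<length gs. hs ! k) - (\<Prod>k<length gs. gs ! k) -
    Polynomial.smult d (\<Sum>k<length gs. u k * prod_except gs k)"
proof -
  have "(\<Prod>k<length gs. hs ! k) = (\<Prod>k<length gs. gs ! k + [:d:] * u k)"
    using assms by (intro prod.cong) auto
  then show ?thesis
    using prod_add_mult_expansion[of "{..<length gs}" "[:d:]" "(!) gs" u]
    by (simp add: prod_except_def const_poly_power)
qed

context complete_dvr
begin

text \<open>As \<open>x\<close> divides \<open>\<pi> ^ t\<close>, a multiplication replaces
  \<open>x * y\<close> by \<open>\<pi> ^ t * y\<close>, where \<open>\<pi> ^ t\<close>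
  cancels.\<close>

lemma power_dvd_of_mult:
  assumes "\<not> \<pi> ^ Suc t dvd x" and "\<pi> ^ r dvd x * y" and "r \<ge> Suc t"
  shows "\<pi> dvd y"
proof -
  obtain z where z: "\<pi> ^ t = x * z" using dvd_power_of_not_power_dvd[OF assms(1)] by auto
  have "\<pi> ^ Suc t dvd (x * y) * z" using assms(2,3) by (meson dvd_mult2 dvd_trans le_imp_power_dvd)
  then have "\<pi> ^ t * \<pi> dvd \<pi> ^ t * y" by (simp add: z ac_simps)
  then show ?thesis using nonzero by simp
qed

lemma not_power_dvd_of_cong:
  assumes "\<not> \<pi> ^ Suc t dvd x" and "\<pi> ^ r dvd y - x" and "r \<ge> Suc t"
  shows "\<not> \<pi> ^ Suc t dvd y"
proof
  assume "\<pi> ^ Suc t dvd y"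
  moreover have "\<pi> ^ Suc t dvd y - x" using assms(2,3) by (meson dvd_trans le_imp_power_dvd)
  ultimately have "\<pi> ^ Suc t dvd y - (y - x)" by (rule dvd_diff)
  then show False using assms(1) by simp
qed

lemma degree_eq_of_power_cong:
  assumes "[:\<pi> ^ r:] dvd x - y" "r > 0" "lead_coeff x = 1" "lead_coeff y = 1"
  shows "Polynomial.degree x = Polynomial.degree y"
  using degree_eq_of_poly_cong[OF assms(1,3,4)] not_power_dvd_1[OF assms(2)] by simp

text \<open>Resultants of nearby factors are congruent modulo a power beyond \<open>t\<close>, so
  one bound \<open>t\<close> serves all approximations.\<close>

lemma gen_resultant_not_power_dvd:
  assumes len: "length hs = length gs"
    and monic: "\<And>k. k < length gs \<Longrightarrow> lead_coeff (gs ! k) = 1"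
      "\<And>k. k < length gs \<Longrightarrow> lead_coeff (hs ! k) = 1"
    and cong: "\<And>k. k < length gs \<Longrightarrow> [:\<pi> ^ r:] dvd hs ! k - gs ! k"
    and res: "\<not> \<pi> ^ Suc t dvd gen_resultant gs" and r: "r \<ge> Suc t"
  shows "\<not> \<pi> ^ Suc t dvd gen_resultant hs"
proof -
  have "\<pi> ^ r dvd gen_resultant hs - gen_resultant gs"
    using len cong degree_eq_of_power_cong[OF cong _ monic(2) monic(1)] r by (intro gen_resultant_cong) auto
  then show ?thesis using not_power_dvd_of_cong[OF res _ r] by blast
qed

lemma const_poly_dvd_mono:
  assumes "[:\<pi> ^ r:] dvd x" "i \<le> r"
  shows "[:\<pi> ^ i:] dvd x"
  using assms by (meson const_poly_dvd_iff dvd_trans le_imp_power_dvd)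

text \<open>A correction of size \<open>\<pi> ^ (s - t)\<close> can remove an error of size
  \<open>\<pi> ^ s\<close>, because the linearised equation is solvable for right-hand sides
  divisible by \<open>\<pi> ^ t\<close>.\<close>

lemma hensel_step:
  assumes monic: "\<And>k. k < length gs \<Longrightarrow> lead_coeff (gs ! k) = 1"
    and f: "lead_coeff f = 1"
    and cong: "[:\<pi> ^ s:] dvd f - (\<Prod>k<length gs. gs ! k)"
    and res: "\<not> \<pi> ^ Suc t dvd gen_resultant gs"
    and s: "s \<ge> 2 * t + 1"
  shows "\<exists>hs. length hs = length gs \<and>
    (\<forall>k<length gs. lead_coeff (hs ! k) = 1 \<and> [:\<pi> ^ (s - t):] dvd hs ! k - gs ! k) \<and>
    [:\<pi> ^ Suc s:] dvd f - (\<Prod>k<length gs. hs ! k)"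
proof -
  let ?G = "\<Prod>k<length gs. gs ! k"
  have G: "lead_coeff ?G = 1" by (simp add: lead_coeff_prod monic)
  have "gs ! k \<noteq> 0" if "k < length gs" for k using monic[OF that] by auto
  then have degG: "Polynomial.degree ?G = total_degree gs" by (intro degree_prod_sum_eq) simp
  have degf: "Polynomial.degree f = Polynomial.degree ?G" using degree_eq_of_power_cong[OF cong _ f G] s by simp
  obtain b where b: "f - ?G = Polynomial.smult (\<pi> ^ s) b" using cong by auto
  \<comment> \<open>The leading terms of the two monic polynomials cancel, so \<open>b\<close> lies
    in the target space of the Sylvester map.\<close>
  have "Polynomial.coeff b i = 0" if "total_degree gs \<le> i" for i
  proof -
    have "Polynomial.coeff (f - ?G) i = 0"
      using that f G degf degG by (cases "i = total_degree gs") (simp_all add: coeff_eq_0)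
    then show ?thesis using nonzero unfolding b by simp
  qed
  then obtain u where u: "\<And>k i. Polynomial.degree (gs ! k) \<le> i \<Longrightarrow> Polynomial.coeff (u k) i = 0"
    and sum: "(\<Sum>k<length gs. u k * prod_except gs k) = Polynomial.smult (gen_resultant gs) b"
    using gen_resultant_bezout[of gs b] by blast
  \<comment> \<open>Multiplying by \<open>z\<close> turns the right-hand side from the resultant
    times \<open>b\<close> into \<open>\<pi> ^ t\<close> times \<open>b\<close>.\<close>
  obtain z where z: "\<pi> ^ t = gen_resultant gs * z" using dvd_power_of_not_power_dvd[OF res] by auto
  let ?d = "\<pi> ^ (s - t)"
  define v where "v k = Polynomial.smult z (u k)" for k
  define hs where "hs = map (\<lambda>k. gs ! k + Polynomial.smult ?d (v k)) [0..<length gs]"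
  have "(\<Sum>k<length gs. v k * prod_except gs k) = Polynomial.smult z (\<Sum>k<length gs. u k * prod_except gs k)"
    by (intro poly_eqI) (simp add: v_def coeff_sum sum_distrib_left)
  also have "\<dots> = Polynomial.smult (\<pi> ^ t) b" by (simp add: sum z mult.commute)
  finally have "Polynomial.smult ?d (\<Sum>k<length gs. v k * prod_except gs k) = f - ?G"
    using s by (simp add: b flip: power_add)
  moreover have "[:?d\<^sup>2:] dvd (\<Prod>k<length gs. hs ! k) - ?G -
      Polynomial.smult ?d (\<Sum>k<length gs. v k * prod_except gs k)"
    by (intro const_poly_square_dvd_expansion) (simp_all add: hs_def)
  ultimately have "[:?d\<^sup>2:] dvd (\<Prod>k<length gs. hs ! k) - f" by simp
  then have "[:\<pi> ^ (2 * (s - t)):] dvd f - (\<Prod>k<length gs. hs ! k)"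
    using dvd_diff_sym by (simp only: power_mult mult.commute[of 2])
  \<comment> \<open>Only the second-order error remains, and 2 (s - t) \<ge> s + 1 because s \<ge> 2
    t + 1.\<close>
  then have "[:\<pi> ^ Suc s:] dvd f - (\<Prod>k<length gs. hs ! k)"
    by (rule const_poly_dvd_mono) (use s in simp)
  moreover have "lead_coeff (hs ! k) = 1" if "k < length gs" for k
    using that monic_add[OF monic[OF that], of "Polynomial.smult ?d (v k)"] u by (simp add: hs_def v_def)
  moreover have "[:?d:] dvd hs ! k - gs ! k" if "k < length gs" for k
    using that by (simp add: hs_def const_poly_dvd_iff)
  ultimately show ?thesis by (intro exI[of _ hs]) (simp add: hs_def)
qed

lemma monic_adic_limit:
  assumes "\<And>i. lead_coeff (g i) = 1" and "\<And>i. Polynomial.degree (g i) = m"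
    and "\<And>i. [:\<pi> ^ (r + i):] dvd g (Suc i) - g i"
  shows "\<exists>h. lead_coeff h = 1 \<and> (\<forall>i. [:\<pi> ^ (r + i):] dvd g i - h)"
proof -
  have "\<exists>l. \<forall>i. \<pi> ^ (r + i) dvd Polynomial.coeff (g i) j - l" for j
    using adic_limit[of r "\<lambda>i. Polynomial.coeff (g i) j"] assms(3)
    by (metis const_poly_dvd_diff_iff)
  then obtain l where l: "\<And>i j. \<pi> ^ (r + i) dvd Polynomial.coeff (g i) j - l j" by metis
  \<comment> \<open>The leading coefficient is set to 1 instead of being taken as a limit, so
    \<open>h\<close> is monic of degree m by construction.\<close>
  define h where "h = Polynomial.monom 1 m + (\<Sum>j<m. Polynomial.monom (l j) j)"
  have coeff: "Polynomial.coeff h j = (if j < m then l j else if j = m then 1 else 0)" for j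
    by (simp add: h_def coeff_sum_monom)
  have "Polynomial.degree h = m"
    using coeff by (intro antisym degree_le le_degree) simp_all
  moreover have "[:\<pi> ^ (r + i):] dvd g i - h" for i
    unfolding const_poly_dvd_diff_iff
  proof
    fix j
    consider "j < m" | "j = m" | "j > m" by linarith
    then show "\<pi> ^ (r + i) dvd Polynomial.coeff (g i) j - Polynomial.coeff h j"
    proof cases
      case 1
      then show ?thesis using l[of i j] by (simp add: coeff)
    next
      case 2
      then show ?thesis using assms(1,2)[of i] by (simp add: coeff)
    next
      case 3
      then show ?thesis using assms(2)[of i] by (simp add: coeff coeff_eq_0)
    qed
  qed
  ultimately show ?thesis using coeff by (intro exI[of _ h]) simp
qed

lemma poly_eq_of_cong:
  assumes "\<And>i. [:\<pi> ^ i:] dvd x - y"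
  shows "x = y"
proof (rule poly_eqI)
  fix j
  have "Polynomial.coeff x j - Polynomial.coeff y j = 0"
    using assms by (intro separated) (simp add: const_poly_dvd_diff_iff)
  then show "Polynomial.coeff x j = Polynomial.coeff y j" by simp
qed

text \<open>Iterates the Newton step by dependent choice: the precision of the product grows while
  \<open>t\<close> stays fixed.\<close>

lemma hensel_existence:
  assumes monic: "\<And>k. k < length gs \<Longrightarrow> lead_coeff (gs ! k) = 1"
    and f: "lead_coeff f = 1"
    and cong: "[:\<pi> ^ s:] dvd f - (\<Prod>k<length gs. gs ! k)"
    and res: "\<not> \<pi> ^ Suc t dvd gen_resultant gs"
    and s: "s \<ge> 2 * t + 1"
  shows "\<exists>hs. length hs = length gs \<and>
    (\<forall>k<length gs. lead_coeff (hs ! k) = 1 \<and> [:\<pi> ^ (s - t):] dvd hs ! k - gs ! k) \<and>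
    f = (\<Prod>k<length gs. hs ! k)"
proof -
  let ?n = "length gs"
  define P where "P i hs \<longleftrightarrow> length hs = ?n \<and>
    (\<forall>k<?n. lead_coeff (hs ! k) = 1 \<and> [:\<pi> ^ (s - t):] dvd hs ! k - gs ! k) \<and>
    [:\<pi> ^ (s + i):] dvd f - (\<Prod>k<?n. hs ! k)" for i hs
  \<comment> \<open>\<open>Q\<close> makes each factor a Cauchy sequence, whereas \<open>P\<close>
    keeps it close to the initial factor.\<close>
  define Q where "Q i hs hs' \<longleftrightarrow> (\<forall>k<?n. [:\<pi> ^ (s - t + i):] dvd hs' ! k - hs ! k)" for i and hs hs' :: "'a poly list"
  have "\<exists>F. \<forall>i. P i (F i) \<and> Q i (F i) (F (Suc i))"
  proof (rule dependent_nat_choice)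
    show "\<exists>hs. P 0 hs" using monic cong by (intro exI[of _ gs]) (simp add: P_def)
  next
    fix hs i assume hs: "P i hs"
    \<comment> \<open>The approximations stay congruent to \<open>gs\<close> modulo
      \<open>\<pi> ^ (s - t)\<close>, and s - t > t.\<close>
    have "\<not> \<pi> ^ Suc t dvd gen_resultant hs"
      using hs monic s by (intro gen_resultant_not_power_dvd[OF _ _ _ _ res, of _ "s - t"]) (auto simp: P_def)
    then obtain hs' where len: "length hs' = ?n"
      and *: "\<And>k. k < ?n \<Longrightarrow> lead_coeff (hs' ! k) = 1"
        "\<And>k. k < ?n \<Longrightarrow> [:\<pi> ^ (s + i - t):] dvd hs' ! k - hs ! k"
        "[:\<pi> ^ Suc (s + i):] dvd f - (\<Prod>k<?n. hs' ! k)"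
      using hensel_step[of hs f "s + i" t] hs f s by (auto simp: P_def)
    have "s + i - t = s - t + i" using s by simp
    then have Q: "Q i hs hs'" using *(2) by (simp add: Q_def)
    have "[:\<pi> ^ (s - t):] dvd hs' ! k - gs ! k" if "k < ?n" for k
    proof (rule dvd_diff_trans)
      show "[:\<pi> ^ (s - t):] dvd hs' ! k - hs ! k"
        using const_poly_dvd_mono[OF *(2)[OF that]] by simp
      show "[:\<pi> ^ (s - t):] dvd hs ! k - gs ! k" using hs that by (simp add: P_def)
    qed
    then have "P (Suc i) hs'" using len * by (simp add: P_def)
    then show "\<exists>hs'. P (Suc i) hs' \<and> Q i hs hs'" using Q by blast
  qed
  then obtain F where P: "\<And>i. P i (F i)" and Q: "\<And>i. Q i (F i) (F (Suc i))" by blast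
  have "\<exists>h. lead_coeff h = 1 \<and> (\<forall>i. [:\<pi> ^ (s - t + i):] dvd F i ! k - h)" if k: "k < ?n" for k
  proof (rule monic_adic_limit)
    fix i
    show "lead_coeff (F i ! k) = 1" using P[of i] k by (simp add: P_def)
    show "Polynomial.degree (F i ! k) = Polynomial.degree (gs ! k)"
      using P[of i] k monic s by (intro degree_eq_of_power_cong[of "s - t"]) (auto simp: P_def)
    show "[:\<pi> ^ (s - t + i):] dvd F (Suc i) ! k - F i ! k" using Q[of i] k by (simp add: Q_def)
  qed
  then obtain h where h: "\<And>k. k < ?n \<Longrightarrow> lead_coeff (h k) = 1"
    "\<And>k i. k < ?n \<Longrightarrow> [:\<pi> ^ (s - t + i):] dvd F i ! k - h k" by metis
  \<comment> \<open>The product of the i-th approximations is congruent modulo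
    \<open>\<pi> ^ i\<close> both to \<open>f\<close> and to the product of the limits.\<close>
  have "f = (\<Prod>k<?n. h k)"
  proof (rule poly_eq_of_cong)
    fix i
    have "[:\<pi> ^ i:] dvd f - (\<Prod>k<?n. F i ! k)"
      using P[of i] by (intro const_poly_dvd_mono[of "s + i" _ i]) (simp_all add: P_def)
    moreover have "[:\<pi> ^ i:] dvd (\<Prod>k<?n. F i ! k) - (\<Prod>k<?n. h k)"
      using const_poly_dvd_mono[OF h(2), of _ i i] by (intro dvd_diff_prod) simp
    ultimately show "[:\<pi> ^ i:] dvd f - (\<Prod>k<?n. h k)" by (rule dvd_diff_trans)
  qed
  moreover have "[:\<pi> ^ (s - t):] dvd h k - gs ! k" if k: "k < ?n" for k
  proof (rule dvd_diff_trans)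
    show "[:\<pi> ^ (s - t):] dvd h k - F 0 ! k" using dvd_diff_sym[OF h(2)[OF k, of 0]] by simp
    show "[:\<pi> ^ (s - t):] dvd F 0 ! k - gs ! k" using P[of 0] k by (simp add: P_def)
  qed
  ultimately show ?thesis using h(1) by (intro exI[of _ "map h [0..<?n]"]) simp
qed

text \<open>Induction on precision: equality of the products forces the linear term of the
  difference to be small, and the adjugate then yields one more factor \<pi> in each
  difference.\<close>

lemma hensel_uniqueness:
  assumes len: "length hs = length gs" "length hs' = length gs"
    and monic: "\<And>k. k < length gs \<Longrightarrow> lead_coeff (gs ! k) = 1"
      "\<And>k. k < length gs \<Longrightarrow> lead_coeff (hs ! k) = 1"
      "\<And>k. k < length gs \<Longrightarrow> lead_coeff (hs' ! k) = 1"
    and cong: "\<And>k. k < length gs \<Longrightarrow> [:\<pi> ^ r:] dvd hs ! k - gs ! k"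
      "\<And>k. k < length gs \<Longrightarrow> [:\<pi> ^ r:] dvd hs' ! k - gs ! k"
    and prod: "(\<Prod>k<length gs. hs ! k) = (\<Prod>k<length gs. hs' ! k)"
    and res: "\<not> \<pi> ^ Suc t dvd gen_resultant gs" and r: "r \<ge> Suc t"
  shows "hs = hs'"
proof -
  let ?n = "length gs"
  have res': "\<not> \<pi> ^ Suc t dvd gen_resultant hs"
    by (rule gen_resultant_not_power_dvd[OF len(1) monic(1,2) cong(1) res r])
  have step: "[:\<pi> ^ (r + i):] dvd hs' ! k - hs ! k" if "k < ?n" for i k
    using that
  proof (induction i arbitrary: k)
    case 0
    then show ?case using dvd_diff_trans[OF cong(2) dvd_diff_sym[OF cong(1)]] by simp
  next
    case (Suc i)
    let ?d = "\<pi> ^ (r + i)"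
    have d: "?d \<noteq> 0" using nonzero by simp
    from Suc.IH have "\<exists>u. hs' ! k - hs ! k = Polynomial.smult ?d u" if "k < ?n" for k
      using that by (auto simp: dvd_def)
    then obtain u where u: "\<And>k. k < ?n \<Longrightarrow> hs' ! k - hs ! k = Polynomial.smult ?d (u k)" by metis
    \<comment> \<open>Both factors are monic of the same degree, so their difference has no
      coefficient at or above it.\<close>
    have zero: "Polynomial.coeff (u k) i = 0" if k: "k < ?n" and i: "Polynomial.degree (hs ! k) \<le> i" for k i
    proof -
      have deg: "Polynomial.degree (hs' ! k) = Polynomial.degree (hs ! k)"
        using degree_eq_of_power_cong[OF cong(1)[OF k] _ monic(2,1)[OF k]] degree_eq_of_power_cong[OF cong(2)[OF k] _ monic(3,1)[OF k]] r by simp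
      have "Polynomial.coeff (hs' ! k - hs ! k) i = 0"
        using i monic(2,3)[OF k] deg
        by (cases "i = Polynomial.degree (hs ! k)") (simp_all add: coeff_eq_0)
      then show ?thesis using nonzero unfolding u[OF k] by simp
    qed
    have "hs' ! k = hs ! k + Polynomial.smult ?d (u k)" if "k < length hs" for k
      using u[of k] that len by (simp add: algebra_simps)
    then have "[:?d\<^sup>2:] dvd (\<Prod>k<length hs. hs' ! k) - (\<Prod>k<length hs. hs ! k) -
        Polynomial.smult ?d (\<Sum>k<length hs. u k * prod_except hs k)"
      using len by (intro const_poly_square_dvd_expansion) simp_all
    \<comment> \<open>Equal products leave only the linear term, divisible by the square of
      \<open>?d\<close>; one factor \<open>?d\<close> then cancels.\<close>
    then have "[:?d\<^sup>2:] dvd Polynomial.smult ?d (\<Sum>k<length hs. u k * prod_except hs k)"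
      using prod len by simp
    then have "[:?d:] dvd (\<Sum>k<length hs. u k * prod_except hs k)"
      using nonzero by (simp add: const_poly_dvd_iff power2_eq_square)
    then have "?d dvd gen_resultant hs * Polynomial.coeff (u k) j" for j
      using zero len Suc.prems by (intro gen_resultant_mult_dvd) auto
    \<comment> \<open>Since r + i > t, the resultant cannot absorb the whole power, so at least one
      \<pi> remains.\<close>
    then have "\<pi> dvd Polynomial.coeff (u k) j" for j
      using r by (intro power_dvd_of_mult[OF res', of "r + i"]) auto
    then show ?case
      unfolding u[OF Suc.prems] by (simp add: const_poly_dvd_iff mult_dvd_mono mult.commute[of \<pi>])
  qed
  show ?thesis
  proof (rule nth_equalityI)
    fix k assume "k < length hs"
    then have "[:\<pi> ^ i:] dvd hs' ! k - hs ! k" for i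
      using const_poly_dvd_mono[OF step[of k i], of i] len by simp
    then show "hs ! k = hs' ! k" using poly_eq_of_cong[of "hs' ! k" "hs ! k"] by simp
  qed (simp add: len)
qed

end

section \<open>From the discriminant bound to existence and uniqueness\<close>

theorem theorem16:
  fixes \<pi> :: "'a::idom"
    and f :: "'a poly"
    and gs :: "'a poly list"
    and n s :: nat
    and t :: enat
  assumes "discrete_valuation_ring (ring_of_type_algebra :: 'a ring)"
    and "maximalideal (PIdl\<^bsub>ring_of_type_algebra\<^esub> \<pi>) ring_of_type_algebra"
    and "adically_complete \<pi>"
    and "lead_coeff f = 1"
    and "discriminant f \<noteq> 0"
    and "n \<ge> 1"
    and "length gs = n"
    and "\<forall>k<n. lead_coeff (gs ! k) = 1 \<and> Polynomial.degree (gs ! k) \<ge> 1"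
    and "t = valuation \<pi> (gen_resultant gs)"
    and "enat s \<ge> valuation \<pi> (discriminant f) + 1"
    and "poly_cong (\<pi> ^ s) f (\<Prod>k<n. gs ! k)"
  shows "\<exists>!hs. length hs = n \<and>
           (\<forall>k<n. lead_coeff (hs ! k) = 1) \<and>
           (\<forall>k<n. poly_cong (\<pi> ^ the_enat (enat s - t)) (hs ! k) (gs ! k)) \<and>
           f = (\<Prod>k<n. hs ! k)"
proof -
  interpret complete_dvr \<pi>
    by (rule complete_dvr.intro[OF dvr_uniformizer[OF assms(1,2)] assms(3)])
  let ?G = "\<Prod>k<n. gs ! k"
  have monic: "lead_coeff (gs ! k) = 1" if "k < n" for k using assms(8) that by blast
  have G: "lead_coeff ?G = 1" by (simp add: lead_coeff_prod monic)
  have cong: "[:\<pi> ^ s:] dvd f - ?G" using assms(11) by (simp add: poly_cong_iff)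
  obtain v where v: "valuation \<pi> (discriminant f) = enat v" "\<not> \<pi> ^ Suc v dvd discriminant f"
    using valuation_eq_enat[OF assms(5)] by metis
  have s: "s \<ge> Suc v" using assms(10) by (simp add: v one_enat_def)
  have "Polynomial.degree f = Polynomial.degree ?G" using degree_eq_of_power_cong[OF cong _ assms(4) G] s by simp
  \<comment> \<open>The valuation v of the discriminant of \<open>f\<close> is below s, so a
    congruence modulo \<open>\<pi> ^ s\<close> transfers the bound to the product.\<close>
  then have "\<pi> ^ s dvd discriminant ?G - discriminant f"
    using discriminant_cong[OF assms(4) G _ cong] by (simp add: dvd_diff_sym)
  then have disc: "\<not> \<pi> ^ Suc v dvd discriminant ?G"
    using not_power_dvd_of_cong[OF v(2) _ s] by blast
  then have "discriminant ?G \<noteq> 0" by auto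
  then have sq: "(gen_resultant gs)\<^sup>2 dvd discriminant ?G"
    using gen_resultant_square_dvd_discriminant[of gs] monic assms(7) by simp
  then have "gen_resultant gs \<noteq> 0" using \<open>discriminant ?G \<noteq> 0\<close> by auto
  then obtain t' where t': "t = enat t'" "\<pi> ^ t' dvd gen_resultant gs"
    "\<not> \<pi> ^ Suc t' dvd gen_resultant gs"
    using valuation_eq_enat assms(9) by metis
  \<comment> \<open>The squared resultant divides the discriminant, whence 2 t' \<le> v < s.\<close>
  have "\<pi> ^ (2 * t') dvd discriminant ?G"
    using t'(2) sq by (metis dvd_power_same dvd_trans mult.commute power_mult)
  then have "2 * t' \<le> v"
    using disc by (meson dvd_trans le_imp_power_dvd not_less_eq_eq)
  then have s2: "s \<ge> 2 * t' + 1" using s by simp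
  \<comment> \<open>Finiteness of \<open>t\<close> reduces the extended subtraction to natural
    numbers.\<close>
  have "the_enat (enat s - t) = s - t'" by (simp add: t'(1))
  show ?thesis
    unfolding poly_cong_iff \<open>the_enat (enat s - t) = s - t'\<close>
  proof (rule ex_ex1I)
    show "\<exists>hs. length hs = n \<and> (\<forall>k<n. lead_coeff (hs ! k) = 1) \<and>
        (\<forall>k<n. [:\<pi> ^ (s - t'):] dvd hs ! k - gs ! k) \<and> f = (\<Prod>k<n. hs ! k)"
      using hensel_existence[of gs f s t'] monic assms(4,7) cong t'(3) s2 by auto
  next
    fix hs hs'
    assume "length hs = n \<and> (\<forall>k<n. lead_coeff (hs ! k) = 1) \<and>
        (\<forall>k<n. [:\<pi> ^ (s - t'):] dvd hs ! k - gs ! k) \<and> f = (\<Prod>k<n. hs ! k)"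
      and "length hs' = n \<and> (\<forall>k<n. lead_coeff (hs' ! k) = 1) \<and>
        (\<forall>k<n. [:\<pi> ^ (s - t'):] dvd hs' ! k - gs ! k) \<and> f = (\<Prod>k<n. hs' ! k)"
    \<comment> \<open>The precision s - t' exceeds t' by the same inequality s \<ge> 2 t' +
      1.\<close>
    then show "hs = hs'"
      using hensel_uniqueness[of hs gs hs' "s - t'" t'] monic assms(7) t'(3) s2 by auto
  qed
qed

end
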